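(* Let $G$ be a complete graph with $n$ vertices and let $I=I(G)$ be the edge ideal of $G$. Then for any $s\ge 1$, $$\operatorname{reg} I^{(s)}=\operatorname{reg} I^s .$$
   Context: Let $k$ be a field and let $R=k[x_1,\ldots,x_n]$, where $x_1,\ldots,x_n$ are the vertices of $G$. The edge ideal $I(G)\subseteq R$ is generated by the products $x_ix_j$ with $\{x_i,x_j\}$ an edge of $G$. The $s$-th symbolic power of an ideal $I$ is $I^{(s)}=\bigcap_{p\in\operatorname{Ass} I}(I^sR_p\cap R)$; for an edge ideal it equals $\bigcap_V P_V^s$, where $V$ runs over the minimal vertex covers of $G$ and $P_V$ is the ideal generated by the variables in $V$. Here $\operatorname{reg}$ denotes Castelnuovo–Mumford regularity as a graded $R$-module. *)

theory Defs
  imports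
    "HOL-Library.Poly_Mapping"
    "HOL-Library.Extended_Real"
    "Graph_Theory.Kuratowski"
begin

interpretation self_module: module "(*) :: 'a::comm_ring_1 \<Rightarrow> 'a \<Rightarrow> 'a"
  by unfold_locales (simp_all add: algebra_simps)

abbreviation is_ideal :: "'a::comm_ring_1 set \<Rightarrow> bool" where
  "is_ideal \<equiv> module.subspace (*)"

abbreviation ideal_gen :: "'a::comm_ring_1 set \<Rightarrow> 'a set" where
  "ideal_gen \<equiv> module.span (*)"

definition ideal_mult :: "'a::comm_ring_1 set \<Rightarrow> 'a set \<Rightarrow> 'a set" where
  "ideal_mult I J = ideal_gen {a * b | a b. a \<in> I \<and> b \<in> J}"

primrec ideal_power :: "'a::comm_ring_1 set \<Rightarrow> nat \<Rightarrow> 'a set" where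
  "ideal_power I 0 = UNIV"
| "ideal_power I (Suc s) = ideal_mult I (ideal_power I s)"

definition prime_ideal :: "'a::comm_ring_1 set \<Rightarrow> bool" where
  "prime_ideal P \<longleftrightarrow> is_ideal P \<and> P \<noteq> UNIV \<and> (\<forall>a b. a * b \<in> P \<longrightarrow> a \<in> P \<or> b \<in> P)"

text \<open>The associated primes of an ideal \<open>I\<close> are those of the module \<open>R/I\<close>, i.e. the prime
  ideals that are annihilators \<open>(I : f)\<close> of a residue class \<open>f + I\<close>.\<close>

definition associated_primes :: "'a::comm_ring_1 set \<Rightarrow> 'a set set" where
  "associated_primes I = {P. prime_ideal P \<and> (\<exists>f. P = {g. g * f \<in> I})}"

text \<open>The contraction \<open>J R\<^sub>P \<inter> R\<close>, i.e. the preimage of \<open>J R\<^sub>P\<close> under \<open>R \<rightarrow> R\<^sub>P\<close>: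
  \<open>f/1\<close> lies in \<open>J R\<^sub>P\<close> iff \<open>g f \<in> J\<close> for some \<open>g \<notin> P\<close>.\<close>

definition localization_contraction :: "'a::comm_ring_1 set \<Rightarrow> 'a set \<Rightarrow> 'a set" where
  "localization_contraction P J = {f. \<exists>g. g \<notin> P \<and> g * f \<in> J}"

definition symbolic_power :: "'a::comm_ring_1 set \<Rightarrow> nat \<Rightarrow> 'a set" where
  "symbolic_power I s = (\<Inter>P\<in>associated_primes I. localization_contraction P (ideal_power I s))"

text \<open>The polynomial ring with coefficients \<open>'k\<close> and one variable for each element of the finite
  type \<open>'v\<close>: finitely supported functions on exponent vectors with the convolution product.\<close>

type_synonym ('v, 'k) mpoly = "('v \<Rightarrow>\<^sub>0 nat) \<Rightarrow>\<^sub>0 'k"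

definition Var :: "'v::finite \<Rightarrow> ('v, 'k::field) mpoly" where
  "Var v = Poly_Mapping.single (Poly_Mapping.single v 1) 1"

text \<open>Simple graphs are symmetric loop-free digraphs without parallel arcs; here the vertices
  are the elements of the type \<open>'v\<close>.\<close>

definition edge_ideal :: "('v::finite, 'e) pre_digraph \<Rightarrow> ('v, 'k::field) mpoly set" where
  "edge_ideal G = ideal_gen {Var u * Var v | u v. (u, v) \<in> arcs_ends G}"

definition monom_degree :: "('v::finite \<Rightarrow>\<^sub>0 nat) \<Rightarrow> nat" where
  "monom_degree m = (\<Sum>v\<in>UNIV. Poly_Mapping.lookup m v)"

definition homogeneous :: "int \<Rightarrow> ('v::finite, 'k::field) mpoly \<Rightarrow> bool" where
  "homogeneous d p \<longleftrightarrow> (\<forall>m\<in>Poly_Mapping.keys p. int (monom_degree m) = d)"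

definition irrelevant_ideal :: "('v::finite, 'k::field) mpoly set" where
  "irrelevant_ideal = ideal_gen (range Var)"

text \<open>An element \<open>f :: nat \<Rightarrow>\<^sub>0 R\<close> is the coordinate vector of an element of a free module.
  The free module with basis \<open>B \<subseteq> \<nat>\<close>, in which the basis element \<open>b\<close> has degree \<open>D b\<close>,
  is the graded module given by the direct sum of the \<open>R(-D b)\<close> over \<open>b \<in> B\<close>.\<close>

definition free_scale ::
  "('v::finite, 'k::field) mpoly \<Rightarrow> (nat \<Rightarrow>\<^sub>0 ('v, 'k) mpoly) \<Rightarrow> (nat \<Rightarrow>\<^sub>0 ('v, 'k) mpoly)" where
  "free_scale r f = Poly_Mapping.map ((*) r) f"

lemma lookup_free_scale [simp]:
  "Poly_Mapping.lookup (free_scale r f) b = r * Poly_Mapping.lookup f b"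
  by (simp add: free_scale_def Poly_Mapping.map.rep_eq when_def)

interpretation free_module: module free_scale
  by (unfold_locales; rule poly_mapping_eqI;
      simp only: lookup_free_scale lookup_add distrib_left distrib_right mult.assoc mult_1_left)

definition free_submodule :: "nat set \<Rightarrow> (nat \<Rightarrow>\<^sub>0 ('v::finite, 'k::field) mpoly) set" where
  "free_submodule B = {f. Poly_Mapping.keys f \<subseteq> B}"

definition free_homogeneous ::
  "(nat \<Rightarrow> int) \<Rightarrow> int \<Rightarrow> (nat \<Rightarrow>\<^sub>0 ('v::finite, 'k::field) mpoly) \<Rightarrow> bool" where
  "free_homogeneous D d f \<longleftrightarrow> (\<forall>b. homogeneous (d - D b) (Poly_Mapping.lookup f b))"

text \<open>
  A minimal graded free resolution of a (homogeneous) ideal \<open>I\<close>, regarded as a graded module: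
  an exact complex
  \<open>\<dots> \<rightarrow> F\<^sub>2 \<rightarrow> F\<^sub>1 \<rightarrow> F\<^sub>0 \<rightarrow> I \<rightarrow> 0\<close>
  with homomorphisms of degree zero \<open>\<delta> i : F\<^sub>i\<^sub>+\<^sub>1 \<rightarrow> F\<^sub>i\<close> and \<open>\<epsilon> : F\<^sub>0 \<rightarrow> I\<close>, where
  \<open>F\<^sub>i = free_submodule (B i)\<close> is graded by the degrees \<open>D i\<close>, such that the image of each
  \<open>\<delta> i\<close> lies in \<open>\<mm> F\<^sub>i\<close> for the irrelevant ideal \<open>\<mm>\<close>.

  The maps are total functions on coordinate vectors; only their restrictions to the \<open>F\<^sub>i\<close>
  matter, and every homomorphism on \<open>F\<^sub>i\<close> extends by zero on the remaining basis vectors. The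
  bases are not required to be finite: for a finitely generated module every minimal graded free
  resolution has finite bases.\<close>

locale minimal_graded_free_resolution =
  fixes I :: "('v::finite, 'k::field) mpoly set"
    and B :: "nat \<Rightarrow> nat set"
    and D :: "nat \<Rightarrow> nat \<Rightarrow> int"
    and \<epsilon> :: "(nat \<Rightarrow>\<^sub>0 ('v, 'k) mpoly) \<Rightarrow> ('v, 'k) mpoly"
    and \<delta> :: "nat \<Rightarrow> (nat \<Rightarrow>\<^sub>0 ('v, 'k) mpoly) \<Rightarrow> (nat \<Rightarrow>\<^sub>0 ('v, 'k) mpoly)"
  assumes augmentation_hom: "module_hom free_scale (*) \<epsilon>"
    and augmentation_graded:
      "\<lbrakk>f \<in> free_submodule (B 0); free_homogeneous (D 0) d f\<rbrakk> \<Longrightarrow> homogeneous d (\<epsilon> f)"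
    and differential_hom: "module_hom free_scale free_scale (\<delta> i)"
    and differential_graded:
      "\<lbrakk>f \<in> free_submodule (B (Suc i)); free_homogeneous (D (Suc i)) d f\<rbrakk>
        \<Longrightarrow> free_homogeneous (D i) d (\<delta> i f)"
    and augmentation_image: "\<epsilon> ` free_submodule (B 0) = I"
    and exact_0: "{f \<in> free_submodule (B 0). \<epsilon> f = 0} = \<delta> 0 ` free_submodule (B 1)"
    and exact_Suc:
      "{f \<in> free_submodule (B (Suc i)). \<delta> i f = 0}
        = \<delta> (Suc i) ` free_submodule (B (Suc (Suc i)))"
    and minimal:
      "f \<in> free_submodule (B (Suc i)) \<Longrightarrow> Poly_Mapping.lookup (\<delta> i f) b \<in> irrelevant_ideal"

text \<open>\<open>has_syzygy_degree I i j\<close> says that the graded Betti number \<open>\<beta>\<^sub>i\<^sub>,\<^sub>j(I)\<close> is nonzero: the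
  \<open>i\<close>-th module of the minimal graded free resolution of \<open>I\<close> (which is unique up to
  isomorphism) has a basis element of degree \<open>j\<close>.\<close>

definition has_syzygy_degree :: "('v::finite, 'k::field) mpoly set \<Rightarrow> nat \<Rightarrow> int \<Rightarrow> bool" where
  "has_syzygy_degree I i j \<longleftrightarrow>
    (\<exists>B D \<epsilon> \<delta>. minimal_graded_free_resolution I B D \<epsilon> \<delta> \<and> (\<exists>b\<in>B i. D i b = j))"

text \<open>\<open>reg I = max {j - i | \<beta>\<^sub>i\<^sub>,\<^sub>j(I) \<noteq> 0}\<close>, with the convention \<open>reg 0 = -\<infinity>\<close>.\<close>

definition regularity :: "('v::finite, 'k::field) mpoly set \<Rightarrow> ereal" where
  "regularity I = Sup {ereal (of_int (j - int i)) | i j. has_syzygy_degree I i j}"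

end

theory Submission
  imports Defs
begin

text \<open>
  Write \<open>|a|\<close> for the degree of an exponent vector \<open>a\<close>. The symbolic power \<open>I\<^sup>(\<^sup>s\<^sup>)\<close> is spanned by the
  monomials with \<open>|a| - a\<^sub>v \<ge> s\<close> for every vertex \<open>v\<close>, and \<open>I\<^sup>s\<close> is its part of degree at least \<open>2s\<close>.
  With at least two vertices both ideals have regularity \<open>2s\<close>; with a single vertex both are zero.

  For the upper bound, the Koszul homology \<open>Tor\<^sub>i(-, k)\<^sub>j\<close> of either ideal vanishes for \<open>j > i + 2s\<close>:
  in multidegree \<open>a\<close>, coning over a vertex with maximal exponent is a contraction, because beyond
  degree \<open>2s\<close> lowering the largest exponent does not leave the ideal. Passing to the kernel of a
  minimal cover lowers \<open>i\<close> by one, so the vanishing bounds the degrees in every minimal resolution.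

  For the lower bound, \<open>x\<^sup>s y\<^sup>s\<close> is a minimal generator of both ideals, and a minimal graded free
  resolution exists by repeatedly lifting bases of \<open>M\<^sub>d\<close> modulo \<open>(\<mm> M)\<^sub>d\<close> in each degree \<open>d\<close>.
\<close>

section \<open>The Koszul complex\<close>

text \<open>Regularity is a supremum over all minimal resolutions, so both the degree bound and the
  presence of a basis vector in degree \<open>2s\<close> are proved for an arbitrary one; existence
  then keeps the supremum from being taken over the empty set. Koszul homology is the invariant that
  is independent of the resolution.

  The maximal exponent sits at different vertices in different multidegrees. This does no harm,
  because the Koszul differential preserves multidegrees and each of them can be contracted
  separately. Only divisions by the cone variable can leave an ideal, so a monomial ideal enters the
  argument merely as a set \<open>A\<close> of exponents. Any \<open>A\<close> between
  \<open>ordinary_exps s\<close> and \<open>symbolic_exps s\<close> works, and so one argument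
  serves both ideals.

  In the construction of a resolution, covers have to be taken of kernels, then of the kernels of
  these covers, and so on. The invariant that survives is that basis degrees are nonnegative and
  each degree occurs finitely often: it is inherited at every stage and reduces generation to linear
  algebra in one degree at a time.\<close>

abbreviation coeff :: "('a \<Rightarrow>\<^sub>0 'b::zero) \<Rightarrow> 'a \<Rightarrow> 'b" where
  "coeff \<equiv> Poly_Mapping.lookup"

abbreviation supp :: "('a \<Rightarrow>\<^sub>0 'b::zero) \<Rightarrow> 'a set" where
  "supp \<equiv> Poly_Mapping.keys"

definition unit_exp :: "'v \<Rightarrow> 'v \<Rightarrow>\<^sub>0 nat" where
  "unit_exp v = Poly_Mapping.single v 1"

lemma coeff_unit_exp [simp]: "coeff (unit_exp v) u = of_bool (u = v)"
  by (auto simp: unit_exp_def lookup_single when_def)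

lemma Var_eq: "Var v = Poly_Mapping.single (unit_exp v) 1"
  by (simp add: Var_def unit_exp_def)

definition square_free_exp :: "'v::finite set \<Rightarrow> 'v \<Rightarrow>\<^sub>0 nat" where
  "square_free_exp \<tau> = (\<Sum>v\<in>\<tau>. unit_exp v)"

lemma coeff_square_free_exp [simp]: "coeff (square_free_exp \<tau>) u = of_bool (u \<in> \<tau>)"
  by (simp add: square_free_exp_def lookup_sum of_bool_def)

lemma exp_minus_plus:
  fixes a e :: "'v \<Rightarrow>\<^sub>0 nat"
  assumes "\<And>u. coeff e u \<le> coeff a u"
  shows "a - e + e = a"
  by (rule poly_mapping_eqI) (simp add: lookup_add lookup_minus assms)

lemma coeff_monomial_mult:
  fixes p :: "('v \<Rightarrow>\<^sub>0 nat) \<Rightarrow>\<^sub>0 'k::comm_ring_1"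
  shows "coeff (Poly_Mapping.single a c * p) (a + m) = c * coeff p m"
  by (simp add: lookup_mult lookup_single when_mult)

text \<open>Subtraction of exponents truncates at zero, so exponents not divisible by the variable
  must be separated. All later coefficient formulas carry this case distinction.\<close>

lemma coeff_unit_exp_mult:
  fixes p :: "('v \<Rightarrow>\<^sub>0 nat) \<Rightarrow>\<^sub>0 'k::comm_ring_1"
  shows "coeff (Poly_Mapping.single (unit_exp u) c * p) m =
    (if coeff m u = 0 then 0 else c * coeff p (m - unit_exp u))"
proof (cases "coeff m u = 0")
  case True
  then have "m \<noteq> unit_exp u + q" for q
    by (auto simp: lookup_add)
  then show ?thesis
    using True by (simp add: lookup_mult lookup_single when_mult)
next
  case False
  then have "unit_exp u + (m - unit_exp u) = m"
    by (subst add.commute, intro exp_minus_plus) auto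
  then show ?thesis
    using False coeff_monomial_mult[of "unit_exp u" c p "m - unit_exp u"] by simp
qed

text \<open>The sign of the face \<open>\<tau>\<close> in the boundary of \<open>\<tau> \<union> {u}\<close>, for the vertex order induced by
  \<open>to_nat\<close>.\<close>

definition koszul_sign :: "'v::finite \<Rightarrow> 'v set \<Rightarrow> 'k::comm_ring_1" where
  "koszul_sign u \<tau> = (- 1) ^ card {w \<in> \<tau>. to_nat w < to_nat u}"

lemma koszul_sign_square [simp]:
  "koszul_sign u \<tau> * koszul_sign u \<tau> = (1 :: 'b::comm_ring_1)"
  "koszul_sign u \<tau> * (koszul_sign u \<tau> * x) = (x :: 'b)"
proof -
  show "koszul_sign u \<tau> * koszul_sign u \<tau> = (1 :: 'b)"
    by (simp add: koszul_sign_def power_mult_distrib[symmetric])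
  then show "koszul_sign u \<tau> * (koszul_sign u \<tau> * x) = x"
    by (simp only: mult.assoc[symmetric] mult_1_left)
qed

lemma koszul_sign_insert:
  assumes "v \<notin> \<rho>"
  shows "koszul_sign u (insert v \<rho>) = (if to_nat v < to_nat u then - koszul_sign u \<rho> else koszul_sign u \<rho>)"
proof -
  have "{w \<in> insert v \<rho>. to_nat w < to_nat u} =
      (if to_nat v < to_nat u then insert v {w \<in> \<rho>. to_nat w < to_nat u} else {w \<in> \<rho>. to_nat w < to_nat u})"
    by auto
  then show ?thesis
    using assms by (simp add: koszul_sign_def)
qed

text \<open>Exactly one of \<open>u\<close> and \<open>v\<close> precedes the other, so inserting
  both changes exactly one of the two signs. The first rule makes boundaries cycles; the second
  makes the cone a contracting homotopy.\<close>

lemma koszul_sign_swap: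
  assumes "u \<noteq> v" "u \<notin> \<rho>" "v \<notin> \<rho>"
  shows "koszul_sign u (insert v \<rho>) * koszul_sign v \<rho> = - (koszul_sign v (insert u \<rho>) * koszul_sign u \<rho>)"
    and "koszul_sign u (insert v \<rho>) * koszul_sign v (insert u \<rho>) = - (koszul_sign u \<rho> * koszul_sign v \<rho>)"
proof -
  have ord: "to_nat v < to_nat u \<longleftrightarrow> \<not> to_nat u < to_nat v"
    using assms(1) by (metis linorder_neq_iff not_less_iff_gr_or_eq to_nat_split)
  show "koszul_sign u (insert v \<rho>) * koszul_sign v \<rho> = - (koszul_sign v (insert u \<rho>) * koszul_sign u \<rho>)"
    and "koszul_sign u (insert v \<rho>) * koszul_sign v (insert u \<rho>) = - (koszul_sign u \<rho> * koszul_sign v \<rho>)"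
    unfolding koszul_sign_insert[OF assms(2)] koszul_sign_insert[OF assms(3)] ord
    by (cases "to_nat u < to_nat v"; simp only: if_True if_False not_True_eq_False not_False_eq_True
        mult_minus_left mult_minus_right minus_minus mult.commute)+
qed

text \<open>The Koszul complex of the variables with coefficients in a free module, in coordinates: a
  chain assigns to each vertex set \<open>\<tau>\<close> the coefficient of the corresponding exterior monomial.\<close>

definition koszul_d ::
  "('v::finite set \<Rightarrow> (nat \<Rightarrow>\<^sub>0 ('v, 'k::field) mpoly)) \<Rightarrow> 'v set \<Rightarrow> (nat \<Rightarrow>\<^sub>0 ('v, 'k) mpoly)" where
  "koszul_d z \<tau> = (\<Sum>u\<in>-\<tau>. free_scale (Poly_Mapping.single (unit_exp u) (koszul_sign u \<tau>)) (z (insert u \<tau>)))"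

lemma coeff_koszul_d:
  "coeff (coeff (koszul_d z \<tau>) b) m =
    (\<Sum>u\<in>-\<tau>. if coeff m u = 0 then 0
      else koszul_sign u \<tau> * coeff (coeff (z (insert u \<tau>)) b) (m - unit_exp u))"
  by (simp add: koszul_d_def lookup_sum coeff_unit_exp_mult)

text \<open>The coefficients of a primitive of a cycle in multidegree \<open>a\<close> are obtained by coning over the
  vertex \<open>c a\<close>. The vertex may depend on the multidegree.\<close>

lemma cone_coefficients:
  fixes Z :: "'v::finite set \<Rightarrow> ('v \<Rightarrow>\<^sub>0 nat) \<Rightarrow> 'k::field" and c :: "('v \<Rightarrow>\<^sub>0 nat) \<Rightarrow> 'v"
  assumes cycle: "\<And>\<tau> m. (\<Sum>u\<in>-\<tau>. if coeff m u = 0 then 0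
      else koszul_sign u \<tau> * Z (insert u \<tau>) (m - unit_exp u)) = 0"
    and cone: "\<And>\<tau> m. Z \<tau> m \<noteq> 0 \<Longrightarrow> coeff (m + square_free_exp \<tau>) (c (m + square_free_exp \<tau>)) \<noteq> 0"
  defines "W \<equiv> \<lambda>\<sigma> m. let v = c (m + square_free_exp \<sigma>) in
      if v \<in> \<sigma> then koszul_sign v (\<sigma> - {v}) * Z (\<sigma> - {v}) (m + unit_exp v) else 0"
  shows "(\<Sum>u\<in>-\<tau>. if coeff m u = 0 then 0
      else koszul_sign u \<tau> * W (insert u \<tau>) (m - unit_exp u)) = Z \<tau> m"
proof -
  \<comment> \<open>The multidegree of the exterior monomial on \<open>\<tau>\<close> with
    coefficient monomial \<open>m\<close>. All pairs of a face and a monomial that meet in the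
    differential share it, hence also the cone vertex \<open>v\<close>.\<close>
  define a where "a = m + square_free_exp \<tau>"
  define v where "v = c a"
  have W: "W (insert u \<tau>) (m - unit_exp u) = (if v \<in> insert u \<tau>
      then koszul_sign v (insert u \<tau> - {v}) * Z (insert u \<tau> - {v}) (m - unit_exp u + unit_exp v) else 0)"
    if "u \<notin> \<tau>" "coeff m u \<noteq> 0" for u
  proof -
    have "m - unit_exp u + square_free_exp (insert u \<tau>) = a"
      unfolding a_def by (rule poly_mapping_eqI) (use that in \<open>auto simp: lookup_add lookup_minus\<close>)
    then show ?thesis
      by (simp add: W_def Let_def v_def[symmetric])
  qed
  show ?thesis
  proof (cases "v \<in> \<tau>")
    \<comment> \<open>Only the summand \<open>u = v\<close> survives, because \<open>W\<close>
      vanishes on faces avoiding \<open>v\<close>, and its two signs cancel. That \<open>v\<close>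
      divides \<open>m\<close> is what \<open>cone\<close> provides.\<close>
    case False
    have "(\<Sum>u\<in>-\<tau>. if coeff m u = 0 then 0 else koszul_sign u \<tau> * W (insert u \<tau>) (m - unit_exp u)) =
        (\<Sum>u\<in>-\<tau>. if u = v then (if coeff m v = 0 then 0
           else Z \<tau> m) else 0)"
    proof (rule sum.cong[OF refl], goal_cases)
      case (1 u)
      show ?case
      proof (cases "u = v \<and> coeff m v \<noteq> 0")
        case True
        then have "m - unit_exp v + unit_exp v = m"
          by (intro exp_minus_plus) auto
        with True False 1 show ?thesis
          by (simp add: W)
      next
        case F: False
        with False 1 show ?thesis by (auto simp: W)
      qed
    qed
    also have "\<dots> = (if coeff m v = 0 then 0 else Z \<tau> m)"
      using False by simp
    also have "\<dots> = Z \<tau> m"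
      using cone[of \<tau> m] False by (cases "Z \<tau> m = 0") (auto simp: a_def v_def lookup_add)
    finally show ?thesis .
  next
    \<comment> \<open>The cycle condition is read at the smaller face \<open>\<rho>\<close> and at
      \<open>m\<close> multiplied by the variable of \<open>v\<close>: its summand at
      \<open>v\<close> is \<open>Z \<tau> m\<close> up to sign, and the remaining ones are, up to
      sign, the summands of the claim.\<close>
    case True
    define \<rho> where "\<rho> = \<tau> - {v}"
    have \<tau>: "\<tau> = insert v \<rho>" "v \<notin> \<rho>"
      using True by (auto simp: \<rho>_def)
    have compl: "- \<rho> = insert v (- \<tau>)"
      using \<tau> by auto
    let ?S = "\<Sum>u\<in>-\<tau>. if coeff m u = 0 then 0
        else koszul_sign u \<rho> * Z (insert u \<rho>) (m - unit_exp u + unit_exp v)"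
    let ?g = "\<lambda>u. if coeff (m + unit_exp v) u = 0 then 0
        else koszul_sign u \<rho> * Z (insert u \<rho>) (m + unit_exp v - unit_exp u)"
    have "0 = sum ?g (-\<rho>)"
      using cycle[of "m + unit_exp v" \<rho>] by (rule sym)
    also have "\<dots> = ?g v + sum ?g (-\<tau>)"
      unfolding compl by (rule sum.insert) (simp_all add: True)
    also have "?g v = koszul_sign v \<rho> * Z \<tau> m"
      by (simp add: \<tau>(1)[symmetric] lookup_add)
    also have "sum ?g (-\<tau>) = ?S"
    proof (rule sum.cong[OF refl])
      fix u assume "u \<in> -\<tau>"
      then have u: "u \<noteq> v"
        using True by auto
      have "m + unit_exp v - unit_exp u = m - unit_exp u + unit_exp v" if "coeff m u \<noteq> 0"
        by (rule poly_mapping_eqI) (use that u in \<open>auto simp: lookup_add lookup_minus\<close>)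
      with u show "?g u = (if coeff m u = 0 then 0
          else koszul_sign u \<rho> * Z (insert u \<rho>) (m - unit_exp u + unit_exp v))"
        by (simp add: lookup_add)
    qed
    finally have eq: "koszul_sign v \<rho> * Z \<tau> m = - ?S"
      unfolding eq_neg_iff_add_eq_0 by (rule sym)
    have "Z \<tau> m = koszul_sign v \<rho> * (koszul_sign v \<rho> * Z \<tau> m)"
      by simp
    also have "\<dots> = - koszul_sign v \<rho> * ?S"
      by (simp only: eq mult_minus_right mult_minus_left)
    also have "\<dots> = (\<Sum>u\<in>-\<tau>. if coeff m u = 0 then 0
        else - (koszul_sign u \<rho> * koszul_sign v \<rho>) * Z (insert u \<rho>) (m - unit_exp u + unit_exp v))"
      unfolding sum_distrib_left by (rule sum.cong) auto
    also have "\<dots> = (\<Sum>u\<in>-\<tau>. if coeff m u = 0 then 0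
        else koszul_sign u \<tau> * W (insert u \<tau>) (m - unit_exp u))"
    proof (rule sum.cong[OF refl], goal_cases)
      case (1 u)
      then have u: "u \<noteq> v" "u \<notin> \<rho>" "u \<notin> \<tau>" "insert u \<tau> - {v} = insert u \<rho>"
        using \<tau> by auto
      have "koszul_sign u \<tau> * koszul_sign v (insert u \<rho>) = - (koszul_sign u \<rho> * koszul_sign v \<rho> :: 'k)"
        unfolding \<tau>(1) by (rule koszul_sign_swap(2)[OF u(1,2) \<tau>(2)])
      with True show ?case
        by (simp add: W u(3,4) mult.assoc[symmetric] \<tau>(1)[symmetric])
    qed
    finally show ?thesis by simp
  qed
qed

text \<open>The pointwise homotopy is reassembled into polynomial chains, which requires finite
  supports. The second conclusion records that each monomial of \<open>w\<close> is a monomial of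
  \<open>z\<close> divided by the cone variable; degrees, face sizes and membership in monomial
  ideals are later read off from it.\<close>

lemma koszul_cone:
  fixes z :: "'v::finite set \<Rightarrow> (nat \<Rightarrow>\<^sub>0 ('v, 'k::field) mpoly)" and c :: "('v \<Rightarrow>\<^sub>0 nat) \<Rightarrow> 'v"
  assumes cycle: "\<And>\<tau>. koszul_d z \<tau> = 0"
    and cone: "\<And>\<tau> b m. m \<in> supp (coeff (z \<tau>) b) \<Longrightarrow>
      coeff (m + square_free_exp \<tau>) (c (m + square_free_exp \<tau>)) \<noteq> 0"
  obtains w where "\<And>\<tau>. koszul_d w \<tau> = z \<tau>"
    and "\<And>\<sigma> b m. m \<in> supp (coeff (w \<sigma>) b) \<Longrightarrow> c (m + square_free_exp \<sigma>) \<in> \<sigma> \<and>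
      m + unit_exp (c (m + square_free_exp \<sigma>)) \<in> supp (coeff (z (\<sigma> - {c (m + square_free_exp \<sigma>)})) b)"
proof -
  define Z where "Z b \<tau> m = coeff (coeff (z \<tau>) b) m" for b \<tau> m
  define W where "W b = (\<lambda>\<sigma> m. let v = c (m + square_free_exp \<sigma>) in
      if v \<in> \<sigma> then koszul_sign v (\<sigma> - {v}) * Z b (\<sigma> - {v}) (m + unit_exp v) else 0)" for b
  have dW: "(\<Sum>u\<in>-\<tau>. if coeff m u = 0 then 0
      else koszul_sign u \<tau> * W b (insert u \<tau>) (m - unit_exp u)) = Z b \<tau> m" for b \<tau> m
    unfolding W_def
  proof (rule cone_coefficients, goal_cases)
    case (1 \<tau> m)
    show ?case
      using arg_cong[OF cycle[of \<tau>], of "\<lambda>f. coeff (coeff f b) m"] by (simp add: coeff_koszul_d Z_def cong: if_cong)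
  next
    case (2 \<tau> m)
    then show ?case
      using cone[of m \<tau> b] by (simp add: Z_def in_keys_iff)
  qed
  have W_nonzero: "c (m + square_free_exp \<sigma>) \<in> \<sigma> \<and>
      m + unit_exp (c (m + square_free_exp \<sigma>)) \<in> supp (coeff (z (\<sigma> - {c (m + square_free_exp \<sigma>)})) b)"
    if "W b \<sigma> m \<noteq> 0" for b \<sigma> m
    using that by (auto simp: W_def Let_def Z_def in_keys_iff split: if_splits)
  have fin_m: "finite {m. W b \<sigma> m \<noteq> 0}" for b \<sigma>
  proof (rule finite_subset)
    show "{m. W b \<sigma> m \<noteq> 0} \<subseteq> (\<Union>v\<in>\<sigma>. (\<lambda>m. m - unit_exp v) ` supp (coeff (z (\<sigma> - {v})) b))"
    proof
      fix m assume "m \<in> {m. W b \<sigma> m \<noteq> 0}"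
      then have *: "c (m + square_free_exp \<sigma>) \<in> \<sigma> \<and>
        m + unit_exp (c (m + square_free_exp \<sigma>)) \<in> supp (coeff (z (\<sigma> - {c (m + square_free_exp \<sigma>)})) b)"
        using W_nonzero by simp
      have "m = m + unit_exp v - unit_exp v" for v
        by simp
      with * show "m \<in> (\<Union>v\<in>\<sigma>. (\<lambda>m. m - unit_exp v) ` supp (coeff (z (\<sigma> - {v})) b))"
        by blast
    qed
  qed simp
  define P where "P b \<sigma> = Abs_poly_mapping (W b \<sigma>)" for b \<sigma>
  have P: "coeff (P b \<sigma>) m = W b \<sigma> m" for b \<sigma> m
    by (simp add: P_def fin_m)
  have fin_b: "finite {b. P b \<sigma> \<noteq> 0}" for \<sigma>
  proof (rule finite_subset)
    show "{b. P b \<sigma> \<noteq> 0} \<subseteq> (\<Union>\<tau>. supp (z \<tau>))"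
    proof
      fix b assume "b \<in> {b. P b \<sigma> \<noteq> 0}"
      then obtain m where "W b \<sigma> m \<noteq> 0"
        by (metis P mem_Collect_eq poly_mapping_eqI lookup_zero)
      with W_nonzero have "supp (coeff (z (\<sigma> - {c (m + square_free_exp \<sigma>)})) b) \<noteq> {}"
        by blast
      then show "b \<in> (\<Union>\<tau>. supp (z \<tau>))"
        by (auto simp: in_keys_iff)
    qed
  qed simp
  define w where "w \<sigma> = Abs_poly_mapping (\<lambda>b. P b \<sigma>)" for \<sigma>
  have w: "coeff (coeff (w \<sigma>) b) m = W b \<sigma> m" for b \<sigma> m
    by (simp add: w_def fin_b P)
  show thesis
  proof
    show "koszul_d w \<tau> = z \<tau>" for \<tau>
      using dW[of _ \<tau>] by (intro poly_mapping_eqI) (simp add: coeff_koszul_d w Z_def cong: if_cong)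
    show "c (m + square_free_exp \<sigma>) \<in> \<sigma> \<and>
      m + unit_exp (c (m + square_free_exp \<sigma>)) \<in> supp (coeff (z (\<sigma> - {c (m + square_free_exp \<sigma>)})) b)"
      if "m \<in> supp (coeff (w \<sigma>) b)" for \<sigma> b m
      using that W_nonzero[of b \<sigma> m] by (simp add: in_keys_iff w)
  qed
qed

lemma koszul_d_diff: "koszul_d (\<lambda>\<tau>. y \<tau> - z \<tau>) \<tau> = koszul_d y \<tau> - koszul_d z \<tau>"
  by (simp add: koszul_d_def free_module.scale_right_diff_distrib sum_subtractf)

lemma koszul_d_hom:
  assumes "module_hom free_scale free_scale \<phi>"
  shows "koszul_d (\<lambda>\<tau>. \<phi> (z \<tau>)) \<tau> = \<phi> (koszul_d z \<tau>)"
proof -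
  interpret \<phi>: module_hom free_scale free_scale \<phi> by fact
  show ?thesis
    by (simp add: koszul_d_def \<phi>.sum \<phi>.scale)
qed

lemma koszul_d_koszul_d: "koszul_d (koszul_d z) \<tau> = 0"
proof -
  define T where "T u v = free_scale (Poly_Mapping.single (unit_exp u + unit_exp v)
      (koszul_sign u \<tau> * koszul_sign v (insert u \<tau>))) (z (insert v (insert u \<tau>)))" for u v
  \<comment> \<open>Each unordered pair of vertices is represented once, in increasing order; the
    transposed term is its negative.\<close>
  define L where "L = {(u, v). u \<notin> \<tau> \<and> v \<notin> \<tau> \<and> to_nat u < to_nat v}"
  have anti: "T u v = - T v u" if "u \<noteq> v" "u \<notin> \<tau>" "v \<notin> \<tau>" for u v
  proof -
    have "koszul_sign u \<tau> * koszul_sign v (insert u \<tau>) = - (koszul_sign v \<tau> * koszul_sign u (insert v \<tau>) :: 'b)"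
      using koszul_sign_swap(1)[OF that, where 'b='b] by (simp add: mult.commute)
    then show ?thesis
      unfolding T_def free_module.scale_minus_left[symmetric] single_uminus[symmetric]
      by (simp add: add.commute insert_commute)
  qed
  have "koszul_d (koszul_d z) \<tau> = (\<Sum>u\<in>-\<tau>. \<Sum>v\<in>-insert u \<tau>. T u v)"
    by (simp add: koszul_d_def T_def free_module.scale_sum_right mult_single)
  also have "\<dots> = (\<Sum>(u, v)\<in>(SIGMA u:-\<tau>. -insert u \<tau>). T u v)"
    by (simp add: sum.Sigma)
  also have "(SIGMA u:-\<tau>. -insert u \<tau>) = L \<union> prod.swap ` L"
  proof (rule set_eqI, clarify)
    fix u v :: 'a
    have "u \<noteq> v \<longleftrightarrow> to_nat u < to_nat v \<or> to_nat v < to_nat u"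
      by (metis linorder_neq_iff to_nat_split)
    then show "(u, v) \<in> (SIGMA u:-\<tau>. -insert u \<tau>) \<longleftrightarrow> (u, v) \<in> L \<union> prod.swap ` L"
      by (auto simp: L_def image_iff)
  qed
  also have "(\<Sum>(u, v)\<in>L \<union> prod.swap ` L. T u v) = (\<Sum>(u, v)\<in>L. T u v) + (\<Sum>(u, v)\<in>prod.swap ` L. T u v)"
    by (intro sum.union_disjoint) (auto simp: L_def)
  also have "(\<Sum>(u, v)\<in>prod.swap ` L. T u v) = (\<Sum>(u, v)\<in>L. T v u)"
    by (subst sum.reindex) (auto simp: case_prod_beta)
  also have "\<dots> = (\<Sum>(u, v)\<in>L. - T u v)"
    by (intro sum.cong refl) (auto simp: L_def intro!: anti)
  finally show ?thesis
    by (simp add: case_prod_beta sum_negf)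
qed

section \<open>Gradings of polynomials and of free modules\<close>

lemma monom_degree_add: "monom_degree (a + b) = monom_degree a + monom_degree b"
  by (simp add: monom_degree_def lookup_add sum.distrib)

lemma monom_degree_unit_exp [simp]: "monom_degree (unit_exp v) = 1"
  by (simp add: monom_degree_def)

lemma monom_degree_zero [simp]: "monom_degree 0 = 0"
  by (simp add: monom_degree_def)

lemma monom_degree_eq_0_iff: "monom_degree m = 0 \<longleftrightarrow> m = 0"
  by (auto simp: monom_degree_def intro: poly_mapping_eqI)

definition hom_comp :: "int \<Rightarrow> ('v::finite, 'k::field) mpoly \<Rightarrow> ('v, 'k) mpoly" where
  "hom_comp d p = Abs_poly_mapping (\<lambda>m. if int (monom_degree m) = d then coeff p m else 0)"

lemma coeff_hom_comp [simp]:
  "coeff (hom_comp d p) m = (if int (monom_degree m) = d then coeff p m else 0)"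
proof -
  have "finite {m. (if int (monom_degree m) = d then coeff p m else 0) \<noteq> 0}"
    by (rule finite_subset[OF _ finite_lookup[of p]]) auto
  then show ?thesis
    by (simp add: hom_comp_def)
qed

definition free_hom_comp ::
  "(nat \<Rightarrow> int) \<Rightarrow> int \<Rightarrow> (nat \<Rightarrow>\<^sub>0 ('v::finite, 'k::field) mpoly) \<Rightarrow> (nat \<Rightarrow>\<^sub>0 ('v, 'k) mpoly)" where
  "free_hom_comp D d f = Abs_poly_mapping (\<lambda>b. hom_comp (d - D b) (coeff f b))"

lemma hom_comp_zero [simp]: "hom_comp d 0 = 0"
  by (rule poly_mapping_eqI) simp

lemma coeff_free_hom_comp [simp]: "coeff (free_hom_comp D d f) b = hom_comp (d - D b) (coeff f b)"
proof -
  have "finite {b. hom_comp (d - D b) (coeff f b) \<noteq> 0}"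
    by (rule finite_subset[OF _ finite_lookup[of f]]) auto
  then show ?thesis
    by (simp add: free_hom_comp_def)
qed

lemma free_homogeneous_iff:
  "free_homogeneous D d f \<longleftrightarrow> (\<forall>b m. coeff (coeff f b) m \<noteq> 0 \<longrightarrow> int (monom_degree m) + D b = d)"
  by (force simp: free_homogeneous_def homogeneous_def in_keys_iff)

lemma free_homogeneousD:
  "\<lbrakk>free_homogeneous D d f; coeff (coeff f b) m \<noteq> 0\<rbrakk> \<Longrightarrow> int (monom_degree m) + D b = d"
  by (simp add: free_homogeneous_iff)

lemma free_homogeneous_zero [simp]: "free_homogeneous D d 0"
  by (simp add: free_homogeneous_iff)

lemma free_homogeneous_add:
  assumes "free_homogeneous D d f" "free_homogeneous D d g"
  shows "free_homogeneous D d (f + g)"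
  unfolding free_homogeneous_iff
proof (intro allI impI)
  fix b m assume "coeff (coeff (f + g) b) m \<noteq> 0"
  then have "coeff (coeff f b) m \<noteq> 0 \<or> coeff (coeff g b) m \<noteq> 0"
    by (auto simp: lookup_add)
  then show "int (monom_degree m) + D b = d"
    using assms by (auto dest: free_homogeneousD)
qed

lemma free_homogeneous_uminus:
  "free_homogeneous D d f \<Longrightarrow> free_homogeneous D d (- f)"
  by (simp add: free_homogeneous_iff)

lemma free_homogeneous_diff:
  "\<lbrakk>free_homogeneous D d f; free_homogeneous D d g\<rbrakk> \<Longrightarrow> free_homogeneous D d (f - g)"
  using free_homogeneous_add[of D d f "- g"] by (simp add: free_homogeneous_uminus)

lemma free_homogeneous_sum:
  "(\<And>x. x \<in> X \<Longrightarrow> free_homogeneous D d (f x)) \<Longrightarrow> free_homogeneous D d (sum f X)"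
  by (induction X rule: infinite_finite_induct) (auto intro: free_homogeneous_add)

lemma free_homogeneous_scale:
  assumes "homogeneous e p" "free_homogeneous D d f"
  shows "free_homogeneous D (d + e) (free_scale p f)"
  unfolding free_homogeneous_iff
proof (intro allI impI)
  fix b m assume "coeff (coeff (free_scale p f) b) m \<noteq> 0"
  then have "m \<in> supp (p * coeff f b)"
    by (simp add: in_keys_iff)
  then obtain m1 m2 where m: "m = m1 + m2" "m1 \<in> supp p" "m2 \<in> supp (coeff f b)"
    using keys_mult by blast
  then have "int (monom_degree m1) = e" "int (monom_degree m2) + D b = d"
    using assms by (auto simp: homogeneous_def in_keys_iff dest: free_homogeneousD)
  then show "int (monom_degree m) + D b = d + e"
    by (simp add: m(1) monom_degree_add)
qed

lemma homogeneous_single: "homogeneous (int (monom_degree m)) (Poly_Mapping.single m c)"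
  by (simp add: homogeneous_def)

lemma free_homogeneous_hom_comp [simp]: "free_homogeneous D d (free_hom_comp D d f)"
  by (auto simp: free_homogeneous_iff split: if_splits)

lemma free_hom_comp_ident: "free_homogeneous D d f \<Longrightarrow> free_hom_comp D d f = f"
  by (intro poly_mapping_eqI) (auto dest: free_homogeneousD)

lemma free_hom_comp_other: "\<lbrakk>free_homogeneous D e f; e \<noteq> d\<rbrakk> \<Longrightarrow> free_hom_comp D d f = 0"
  by (intro poly_mapping_eqI) (auto dest: free_homogeneousD)

lemma free_hom_comp_zero [simp]: "free_hom_comp D d 0 = 0"
  by (intro poly_mapping_eqI) simp

lemma free_hom_comp_add: "free_hom_comp D d (f + g) = free_hom_comp D d f + free_hom_comp D d g"
  by (intro poly_mapping_eqI) (simp add: lookup_add)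

lemma free_hom_comp_sum: "free_hom_comp D d (sum f X) = (\<Sum>x\<in>X. free_hom_comp D d (f x))"
  by (induction X rule: infinite_finite_induct) (auto simp: free_hom_comp_add)

definition free_degrees :: "(nat \<Rightarrow> int) \<Rightarrow> (nat \<Rightarrow>\<^sub>0 ('v::finite, 'k::field) mpoly) \<Rightarrow> int set" where
  "free_degrees D f = (\<Union>b\<in>supp f. (\<lambda>m. int (monom_degree m) + D b) ` supp (coeff f b))"

lemma finite_free_degrees [simp]: "finite (free_degrees D f)"
  by (simp add: free_degrees_def)

lemma free_degreesI: "coeff (coeff f b) m \<noteq> 0 \<Longrightarrow> int (monom_degree m) + D b \<in> free_degrees D f"
  unfolding free_degrees_def by (rule UN_I[of b]) (auto simp: in_keys_iff)

lemma free_hom_comp_outside: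
  assumes "d \<notin> free_degrees D f"
  shows "free_hom_comp D d f = 0"
proof (intro poly_mapping_eqI)
  show "coeff (coeff (free_hom_comp D d f) b) m = coeff (coeff 0 b) m" for b m
    using free_degreesI[of f b m D] assms by (cases "coeff (coeff f b) m = 0") auto
qed

lemma sum_free_hom_comp: "(\<Sum>d\<in>free_degrees D f. free_hom_comp D d f) = f"
proof (intro poly_mapping_eqI)
  fix b m
  have "coeff (coeff (\<Sum>d\<in>free_degrees D f. free_hom_comp D d f) b) m =
      (\<Sum>d\<in>free_degrees D f. if d = int (monom_degree m) + D b then coeff (coeff f b) m else 0)"
    unfolding lookup_sum by (intro sum.cong refl) auto
  also have "\<dots> = coeff (coeff f b) m"
    using free_degreesI[of f b m D] by auto
  finally show "coeff (coeff (\<Sum>d\<in>free_degrees D f. free_hom_comp D d f) b) m = coeff (coeff f b) m" .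
qed

lemma free_submodule_iff: "f \<in> free_submodule B \<longleftrightarrow> (\<forall>b. b \<notin> B \<longrightarrow> coeff f b = 0)"
  by (auto simp: free_submodule_def in_keys_iff)

lemma subspace_free_submodule: "free_module.subspace (free_submodule B)"
  by (rule free_module.subspaceI) (auto simp: free_submodule_iff lookup_add)

lemma free_hom_comp_in_free_submodule:
  "f \<in> free_submodule B \<Longrightarrow> free_hom_comp D d f \<in> free_submodule B"
  by (simp add: free_submodule_iff)

definition graded_submodule ::
  "nat set \<Rightarrow> (nat \<Rightarrow> int) \<Rightarrow> (nat \<Rightarrow>\<^sub>0 ('v::finite, 'k::field) mpoly) set \<Rightarrow> bool" where
  "graded_submodule B D M \<longleftrightarrow> free_module.subspace M \<and> M \<subseteq> free_submodule B \<and>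
    (\<forall>f\<in>M. \<forall>d. free_hom_comp D d f \<in> M)"

section \<open>Graded pieces of Koszul homology\<close>

lemma koszul_d_homogeneous:
  assumes "\<And>\<sigma>. free_homogeneous D (j - int (card \<sigma>)) (w \<sigma>)"
  shows "free_homogeneous D (j - int (card \<tau>)) (koszul_d w \<tau>)"
  unfolding koszul_d_def
proof (rule free_homogeneous_sum)
  fix u assume "u \<in> - \<tau>"
  then have "int (card (insert u \<tau>)) = int (card \<tau>) + 1"
    by simp
  then have "free_homogeneous D (j - int (card \<tau>) - 1) (w (insert u \<tau>))"
    using assms[of "insert u \<tau>"] by (simp add: algebra_simps)
  from free_homogeneous_scale[OF homogeneous_single this, of "unit_exp u"]
  show "free_homogeneous D (j - int (card \<tau>))
      (free_scale (Poly_Mapping.single (unit_exp u) (koszul_sign u \<tau>)) (w (insert u \<tau>)))"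
    by simp
qed

lemma koszul_d_card:
  assumes "\<And>\<sigma>. card \<sigma> \<noteq> Suc i \<longrightarrow> w \<sigma> = 0" "card \<tau> \<noteq> i"
  shows "koszul_d w \<tau> = 0"
  unfolding koszul_d_def by (rule sum.neutral) (use assms in auto)

lemma koszul_d_in_subspace:
  assumes "free_module.subspace M" "\<And>\<sigma>. w \<sigma> \<in> M"
  shows "koszul_d w \<tau> \<in> M"
  unfolding koszul_d_def
  by (intro free_module.subspace_sum free_module.subspace_scale assms)

text \<open>Vanishing of the degree \<open>j\<close> part of the \<open>i\<close>-th Koszul homology \<open>Tor\<^sub>i(M, k)\<close> of the variables
  on \<open>M\<close>.\<close>

definition koszul_vanishing ::
  "(nat \<Rightarrow> int) \<Rightarrow> (nat \<Rightarrow>\<^sub>0 ('v::finite, 'k::field) mpoly) set \<Rightarrow> nat \<Rightarrow> int \<Rightarrow> bool" where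
  "koszul_vanishing D M i j \<longleftrightarrow>
    (\<forall>z. (\<forall>\<tau>. z \<tau> \<in> M \<and> free_homogeneous D (j - int (card \<tau>)) (z \<tau>) \<and>
            (card \<tau> \<noteq> i \<longrightarrow> z \<tau> = 0) \<and> koszul_d z \<tau> = 0) \<longrightarrow>
      (\<exists>w. \<forall>\<sigma>. w \<sigma> \<in> M \<and> free_homogeneous D (j - int (card \<sigma>)) (w \<sigma>) \<and>
            (card \<sigma> \<noteq> Suc i \<longrightarrow> w \<sigma> = 0) \<and> koszul_d w \<sigma> = z \<sigma>))"

lemma koszul_vanishingD:
  assumes "koszul_vanishing D M i j"
    and "\<And>\<tau>. z \<tau> \<in> M" "\<And>\<tau>. free_homogeneous D (j - int (card \<tau>)) (z \<tau>)"
    and "\<And>\<tau>. card \<tau> \<noteq> i \<Longrightarrow> z \<tau> = 0" "\<And>\<tau>. koszul_d z \<tau> = 0"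
  obtains w where "\<And>\<sigma>. w \<sigma> \<in> M" "\<And>\<sigma>. free_homogeneous D (j - int (card \<sigma>)) (w \<sigma>)"
    and "\<And>\<sigma>. card \<sigma> \<noteq> Suc i \<longrightarrow> w \<sigma> = 0" "\<And>\<sigma>. koszul_d w \<sigma> = z \<sigma>"
  using assms unfolding koszul_vanishing_def by (metis (no_types, lifting))

text \<open>Dividing by the cone variable lowers the polynomial degree by one while the face gains
  one vertex, so the total degree \<open>j\<close> is kept and the homological degree rises by
  one.\<close>

lemma graded_koszul_cone:
  fixes z :: "'v::finite set \<Rightarrow> (nat \<Rightarrow>\<^sub>0 ('v, 'k::field) mpoly)" and c :: "('v \<Rightarrow>\<^sub>0 nat) \<Rightarrow> 'v"
  assumes "\<And>\<tau>. koszul_d z \<tau> = 0"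
    and "\<And>\<tau> b m. m \<in> supp (coeff (z \<tau>) b) \<Longrightarrow>
      coeff (m + square_free_exp \<tau>) (c (m + square_free_exp \<tau>)) \<noteq> 0"
    and homog: "\<And>\<tau>. free_homogeneous D (j - int (card \<tau>)) (z \<tau>)"
    and card: "\<And>\<tau>. card \<tau> \<noteq> i \<Longrightarrow> z \<tau> = 0"
  obtains w where "\<And>\<sigma>. free_homogeneous D (j - int (card \<sigma>)) (w \<sigma>)"
    and "\<And>\<sigma>. card \<sigma> \<noteq> Suc i \<longrightarrow> w \<sigma> = 0"
    and "\<And>\<sigma>. koszul_d w \<sigma> = z \<sigma>"
    and "\<And>\<sigma> b m. m \<in> supp (coeff (w \<sigma>) b) \<longrightarrow> c (m + square_free_exp \<sigma>) \<in> \<sigma> \<and>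
      m + unit_exp (c (m + square_free_exp \<sigma>)) \<in> supp (coeff (z (\<sigma> - {c (m + square_free_exp \<sigma>)})) b)"
proof -
  obtain w where dw: "\<And>\<tau>. koszul_d w \<tau> = z \<tau>"
    and w: "\<And>\<sigma> b m. m \<in> supp (coeff (w \<sigma>) b) \<Longrightarrow> c (m + square_free_exp \<sigma>) \<in> \<sigma> \<and>
      m + unit_exp (c (m + square_free_exp \<sigma>)) \<in> supp (coeff (z (\<sigma> - {c (m + square_free_exp \<sigma>)})) b)"
    using koszul_cone[of z c] assms(1,2) by blast
  have *: "int (monom_degree m) + D b = j - int (card \<sigma>) \<and> card \<sigma> = Suc i"
    if m: "coeff (coeff (w \<sigma>) b) m \<noteq> 0" for \<sigma> b m
  proof -
    define v where "v = c (m + square_free_exp \<sigma>)"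
    have v: "v \<in> \<sigma>" "coeff (coeff (z (\<sigma> - {v})) b) (m + unit_exp v) \<noteq> 0"
      using w[of m \<sigma> b] m by (auto simp: v_def in_keys_iff)
    then have "z (\<sigma> - {v}) \<noteq> 0"
      by auto
    then have "card (\<sigma> - {v}) = i"
      using card by blast
    with v(1) have "card \<sigma> = Suc i"
      by (metis card_Suc_Diff1 finite)
    moreover have "int (monom_degree m) + 1 + D b = j - int i"
      using free_homogeneousD[OF homog v(2)] \<open>card (\<sigma> - {v}) = i\<close> by (simp add: monom_degree_add)
    ultimately show ?thesis
      by simp
  qed
  show thesis
  proof (rule that[OF _ _ dw])
    show "m \<in> supp (coeff (w \<sigma>) b) \<longrightarrow> c (m + square_free_exp \<sigma>) \<in> \<sigma> \<and>
      m + unit_exp (c (m + square_free_exp \<sigma>)) \<in> supp (coeff (z (\<sigma> - {c (m + square_free_exp \<sigma>)})) b)" for \<sigma> b m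
      using w by blast
    show "free_homogeneous D (j - int (card \<sigma>)) (w \<sigma>)" for \<sigma>
      unfolding free_homogeneous_iff using * by blast
    show "card \<sigma> \<noteq> Suc i \<longrightarrow> w \<sigma> = 0" for \<sigma>
      using * by (metis lookup_zero poly_mapping_eqI)
  qed
qed

text \<open>In a nonzero multidegree some variable occurs, and coning over it is a contraction.
  Multidegree zero contains only constants on the empty face; they account for
  \<open>Tor\<^sub>0(F, k)\<close> and are excluded by \<open>const\<close>.\<close>

lemma free_koszul_exact:
  fixes z :: "'v::finite set \<Rightarrow> (nat \<Rightarrow>\<^sub>0 ('v, 'k::field) mpoly)"
  assumes cycle: "\<And>\<tau>. koszul_d z \<tau> = 0" and mem: "\<And>\<tau>. z \<tau> \<in> free_submodule B"
    and homog: "\<And>\<tau>. free_homogeneous D (j - int (card \<tau>)) (z \<tau>)"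
    and card: "\<And>\<tau>. card \<tau> \<noteq> i \<Longrightarrow> z \<tau> = 0"
    and const: "\<And>b. coeff (coeff (z {}) b) 0 = 0"
  obtains w where "\<And>\<sigma>. w \<sigma> \<in> free_submodule B" "\<And>\<sigma>. free_homogeneous D (j - int (card \<sigma>)) (w \<sigma>)"
    and "\<And>\<sigma>. card \<sigma> \<noteq> Suc i \<longrightarrow> w \<sigma> = 0" "\<And>\<sigma>. koszul_d w \<sigma> = z \<sigma>"
proof -
  define c :: "('v \<Rightarrow>\<^sub>0 nat) \<Rightarrow> 'v" where "c a = (SOME v. coeff a v \<noteq> 0)" for a
  have c: "coeff a (c a) \<noteq> 0" if "a \<noteq> 0" for a
  proof -
    have "\<exists>v. coeff a v \<noteq> 0"
      using that by (metis poly_mapping_eqI lookup_zero)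
    then show ?thesis
      unfolding c_def by (rule someI_ex)
  qed
  have cone: "coeff (m + square_free_exp \<tau>) (c (m + square_free_exp \<tau>)) \<noteq> 0"
    if "m \<in> supp (coeff (z \<tau>) b)" for \<tau> b m
  proof (rule c, rule notI)
    assume "m + square_free_exp \<tau> = 0"
    then have "coeff m u + of_bool (u \<in> \<tau>) = (0 :: nat)" for u
      by (metis coeff_square_free_exp lookup_add lookup_zero)
    then have "coeff m u = 0" "u \<notin> \<tau>" for u
      by (metis add_is_0, metis add_is_0 of_bool_eq(2) zero_neq_one)
    then have "\<tau> = {}" "m = 0"
      by (auto intro: poly_mapping_eqI)
    with that const show False
      by (simp add: in_keys_iff)
  qed
  obtain w where w: "\<And>\<sigma>. free_homogeneous D (j - int (card \<sigma>)) (w \<sigma>)"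
      "\<And>\<sigma>. card \<sigma> \<noteq> Suc i \<longrightarrow> w \<sigma> = 0" "\<And>\<sigma>. koszul_d w \<sigma> = z \<sigma>"
    and supp_w: "\<And>\<sigma> b m. m \<in> supp (coeff (w \<sigma>) b) \<longrightarrow> c (m + square_free_exp \<sigma>) \<in> \<sigma> \<and>
      m + unit_exp (c (m + square_free_exp \<sigma>)) \<in> supp (coeff (z (\<sigma> - {c (m + square_free_exp \<sigma>)})) b)"
    using graded_koszul_cone[of z c D j i, OF cycle _ homog] cone card by blast
  have "w \<sigma> \<in> free_submodule B" for \<sigma>
    unfolding free_submodule_iff
  proof (intro allI impI poly_mapping_eqI, rule ccontr)
    fix b m assume "b \<notin> B" "coeff (coeff (w \<sigma>) b) m \<noteq> coeff 0 m"
    then obtain \<rho> n where "n \<in> supp (coeff (z \<rho>) b)"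
      using supp_w by (metis in_keys_iff lookup_zero)
    with mem \<open>b \<notin> B\<close> show False
      by (metis free_submodule_iff keys_zero empty_iff)
  qed
  with w that show thesis
    by blast
qed

section \<open>Covers by free modules and dimension shifting\<close>

locale graded_cover =
  fixes D\<^sub>0 :: "nat \<Rightarrow> int" and M :: "(nat \<Rightarrow>\<^sub>0 ('v::finite, 'k::field) mpoly) set"
    and B :: "nat set" and D :: "nat \<Rightarrow> int"
    and \<phi> :: "(nat \<Rightarrow>\<^sub>0 ('v, 'k) mpoly) \<Rightarrow> (nat \<Rightarrow>\<^sub>0 ('v, 'k) mpoly)"
  assumes module_hom: "module_hom free_scale free_scale \<phi>"
    and graded: "\<lbrakk>f \<in> free_submodule B; free_homogeneous D d f\<rbrakk> \<Longrightarrow> free_homogeneous D\<^sub>0 d (\<phi> f)"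
    and image: "\<phi> ` free_submodule B = M"
begin

sublocale \<phi>: module_hom free_scale free_scale \<phi>
  by (fact module_hom)

definition kernel :: "(nat \<Rightarrow>\<^sub>0 ('v, 'k) mpoly) set" where
  "kernel = {f \<in> free_submodule B. \<phi> f = 0}"

lemma free_hom_comp_image:
  assumes "f \<in> free_submodule B"
  shows "free_hom_comp D\<^sub>0 d (\<phi> f) = \<phi> (free_hom_comp D d f)"
proof -
  have "free_hom_comp D\<^sub>0 d (\<phi> f) = free_hom_comp D\<^sub>0 d (\<phi> (\<Sum>e\<in>free_degrees D f. free_hom_comp D e f))"
    by (simp add: sum_free_hom_comp)
  also have "\<dots> = (\<Sum>e\<in>free_degrees D f. free_hom_comp D\<^sub>0 d (\<phi> (free_hom_comp D e f)))"
    by (simp add: \<phi>.sum free_hom_comp_sum)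
  also have "\<dots> = (\<Sum>e\<in>free_degrees D f. if e = d then \<phi> (free_hom_comp D d f) else 0)"
  proof (rule sum.cong[OF refl])
    fix e
    have "free_homogeneous D\<^sub>0 e (\<phi> (free_hom_comp D e f))"
      by (intro graded free_hom_comp_in_free_submodule assms free_homogeneous_hom_comp)
    then show "free_hom_comp D\<^sub>0 d (\<phi> (free_hom_comp D e f)) = (if e = d then \<phi> (free_hom_comp D d f) else 0)"
      by (auto simp: free_hom_comp_ident free_hom_comp_other)
  qed
  also have "\<dots> = \<phi> (free_hom_comp D d f)"
    by (cases "d \<in> free_degrees D f") (auto simp: free_hom_comp_outside \<phi>.zero)
  finally show ?thesis .
qed

text \<open>The last conclusion makes zero lift to zero, so that a lifted chain stays concentrated
  in its homological degree.\<close>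

lemma homogeneous_lift:
  assumes "y \<in> M" "free_homogeneous D\<^sub>0 d y"
  obtains x where "x \<in> free_submodule B" "free_homogeneous D d x" "\<phi> x = y" "y = 0 \<Longrightarrow> x = 0"
proof (cases "y = 0")
  case True
  then show ?thesis
    using that[of 0] by (simp add: \<phi>.zero free_submodule_iff)
next
  case False
  obtain f where f: "f \<in> free_submodule B" "\<phi> f = y"
    using assms(1) image by blast
  have "\<phi> (free_hom_comp D d f) = y"
    using free_hom_comp_image[OF f(1), of d] f(2) assms(2) by (simp add: free_hom_comp_ident)
  then show ?thesis
    using that[of "free_hom_comp D d f"] False f(1) by (simp add: free_hom_comp_in_free_submodule)
qed

lemma chain_lift:
  assumes "\<And>\<sigma>. u \<sigma> \<in> M" "\<And>\<sigma>. free_homogeneous D\<^sub>0 (j - int (card \<sigma>)) (u \<sigma>)"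
  obtains u' where "\<And>\<sigma>. u' \<sigma> \<in> free_submodule B" "\<And>\<sigma>. free_homogeneous D (j - int (card \<sigma>)) (u' \<sigma>)"
    and "\<And>\<sigma>. \<phi> (u' \<sigma>) = u \<sigma>" "\<And>\<sigma>. u \<sigma> = 0 \<longrightarrow> u' \<sigma> = 0"
proof -
  have "\<exists>x. x \<in> free_submodule B \<and> free_homogeneous D (j - int (card \<sigma>)) x \<and> \<phi> x = u \<sigma> \<and> (u \<sigma> = 0 \<longrightarrow> x = 0)" for \<sigma>
    by (rule homogeneous_lift[OF assms(1)[of \<sigma>] assms(2)[of \<sigma>]]) blast
  then show ?thesis
    using that by metis
qed

lemma graded_submodule_kernel: "graded_submodule B D kernel"
  unfolding graded_submodule_def
proof (intro conjI ballI allI)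
  show "free_module.subspace kernel"
    using subspace_free_submodule[of B]
    by (intro free_module.subspaceI)
      (auto simp: kernel_def \<phi>.zero \<phi>.add \<phi>.scale free_module.subspace_def)
  show "kernel \<subseteq> free_submodule B"
    by (auto simp: kernel_def)
  show "free_hom_comp D d f \<in> kernel" if "f \<in> kernel" for f d
    using that free_hom_comp_image[of f d] by (simp add: kernel_def free_hom_comp_in_free_submodule)
qed

end

text \<open>Minimality is the inclusion of the kernel in the irrelevant ideal times the free module,
  expressed through constant terms.\<close>

locale minimal_cover = graded_cover D\<^sub>0 M B D \<phi>
  for D\<^sub>0 and M :: "(nat \<Rightarrow>\<^sub>0 ('v::finite, 'k::field) mpoly) set" and B D \<phi> +
  assumes minimal: "\<lbrakk>f \<in> free_submodule B; \<phi> f = 0\<rbrakk> \<Longrightarrow> coeff (coeff f b) 0 = 0"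
begin

text \<open>The connecting homomorphism \<open>Tor\<^sub>i\<^sub>+\<^sub>1(M, k) \<rightarrow> Tor\<^sub>i(kernel, k)\<close> is surjective, also for \<open>i = 0\<close>
  because the cover is minimal.\<close>

lemma koszul_vanishing_kernel:
  assumes "koszul_vanishing D\<^sub>0 M (Suc i) j"
  shows "koszul_vanishing D kernel i j"
  unfolding koszul_vanishing_def
proof (intro allI impI)
  fix z assume *: "\<forall>\<tau>. z \<tau> \<in> kernel \<and> free_homogeneous D (j - int (card \<tau>)) (z \<tau>) \<and>
            (card \<tau> \<noteq> i \<longrightarrow> z \<tau> = 0) \<and> koszul_d z \<tau> = 0"
  have z: "z \<tau> \<in> free_submodule B" "\<phi> (z \<tau>) = 0" "koszul_d z \<tau> = 0"
      "free_homogeneous D (j - int (card \<tau>)) (z \<tau>)" "card \<tau> \<noteq> i \<Longrightarrow> z \<tau> = 0" for \<tau>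
    using * by (auto simp: kernel_def)
  obtain w where w: "\<And>\<sigma>. w \<sigma> \<in> free_submodule B" "\<And>\<sigma>. free_homogeneous D (j - int (card \<sigma>)) (w \<sigma>)"
      "\<And>\<sigma>. card \<sigma> \<noteq> Suc i \<longrightarrow> w \<sigma> = 0" "\<And>\<sigma>. koszul_d w \<sigma> = z \<sigma>"
    using free_koszul_exact[OF z(3,1,4,5) minimal[OF z(1,2)]] by blast
  have cycle: "koszul_d (\<lambda>\<sigma>. \<phi> (w \<sigma>)) \<tau> = 0" for \<tau>
    by (simp add: koszul_d_hom[OF module_hom] w(4) z(2))
  have mem: "\<phi> (w \<sigma>) \<in> M" for \<sigma>
    using w image by auto
  have homog: "free_homogeneous D\<^sub>0 (j - int (card \<sigma>)) (\<phi> (w \<sigma>))" for \<sigma>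
    by (intro graded w)
  have card: "\<phi> (w \<sigma>) = 0" if "card \<sigma> \<noteq> Suc i" for \<sigma>
    using w(3) that by (simp add: \<phi>.zero)
  obtain u where u: "\<And>\<sigma>. u \<sigma> \<in> M" "\<And>\<sigma>. free_homogeneous D\<^sub>0 (j - int (card \<sigma>)) (u \<sigma>)"
      "\<And>\<sigma>. card \<sigma> \<noteq> Suc (Suc i) \<longrightarrow> u \<sigma> = 0" "\<And>\<sigma>. koszul_d u \<sigma> = \<phi> (w \<sigma>)"
    using koszul_vanishingD[OF assms mem homog card cycle] by blast
  obtain u' where u': "\<And>\<sigma>. u' \<sigma> \<in> free_submodule B" "\<And>\<sigma>. free_homogeneous D (j - int (card \<sigma>)) (u' \<sigma>)"
      "\<And>\<sigma>. \<phi> (u' \<sigma>) = u \<sigma>" "\<And>\<sigma>. u \<sigma> = 0 \<longrightarrow> u' \<sigma> = 0"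
    using chain_lift[OF u(1,2)] by blast
  \<comment> \<open>The chain \<open>w\<close> and the boundary of \<open>u'\<close> have the same
    image in \<open>M\<close>. Hence their difference takes values in the kernel, and its boundary
    is still \<open>z\<close> because boundaries are cycles.\<close>
  define y where "y \<sigma> = w \<sigma> - koszul_d u' \<sigma>" for \<sigma>
  have "\<phi> (koszul_d u' \<sigma>) = \<phi> (w \<sigma>)" for \<sigma>
    using koszul_d_hom[OF module_hom, of u' \<sigma>] by (simp add: u' u)
  then have "y \<sigma> \<in> kernel" for \<sigma>
    using w(1) koszul_d_in_subspace[OF subspace_free_submodule u'(1)]
    by (simp add: kernel_def y_def \<phi>.diff free_module.subspace_diff[OF subspace_free_submodule])
  moreover have "free_homogeneous D (j - int (card \<sigma>)) (y \<sigma>)" for \<sigma>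
    unfolding y_def by (intro free_homogeneous_diff w koszul_d_homogeneous u')
  moreover have "y \<sigma> = 0" if "card \<sigma> \<noteq> Suc i" for \<sigma>
  proof -
    have "koszul_d u' \<sigma> = 0"
      by (rule koszul_d_card[OF _ that]) (simp add: u'(4) u(3))
    then show ?thesis
      by (simp add: y_def w(3) that)
  qed
  moreover have "koszul_d y \<sigma> = z \<sigma>" for \<sigma>
    unfolding y_def koszul_d_diff by (simp add: koszul_d_koszul_d w(4))
  ultimately show "\<exists>w. \<forall>\<sigma>. w \<sigma> \<in> kernel \<and> free_homogeneous D (j - int (card \<sigma>)) (w \<sigma>) \<and>
            (card \<sigma> \<noteq> Suc i \<longrightarrow> w \<sigma> = 0) \<and> koszul_d w \<sigma> = z \<sigma>"
    by blast
qed

text \<open>If \<open>Tor\<^sub>0(M, k)\<close> vanishes in degree \<open>j\<close>, the image of a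
  basis vector of that degree is a combination of multiples of elements of \<open>M\<close> by
  variables. Lifting this combination yields a kernel element whose coordinate at \<open>b\<close>
  has constant term 1, against minimality.\<close>

lemma koszul_vanishing_generator:
  assumes "koszul_vanishing D\<^sub>0 M 0 j" "b \<in> B"
  shows "D b \<noteq> j"
proof
  assume j: "D b = j"
  define e :: "nat \<Rightarrow>\<^sub>0 ('v, 'k) mpoly" where "e = Poly_Mapping.single b 1"
  define z where "z \<tau> = (if \<tau> = {} then \<phi> e else 0)" for \<tau> :: "'v set"
  have e: "e \<in> free_submodule B" "free_homogeneous D j e"
    using assms(2) j
    by (auto simp: e_def free_submodule_iff free_homogeneous_iff lookup_single when_def lookup_one)
  have "0 \<in> M"
    using image \<phi>.zero free_module.subspace_0[OF subspace_free_submodule] by (metis image_eqI)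
  then have mem: "z \<tau> \<in> M" for \<tau>
    using e(1) image by (auto simp: z_def)
  have homog: "free_homogeneous D\<^sub>0 (j - int (card \<tau>)) (z \<tau>)" for \<tau>
    using e graded by (simp add: z_def)
  have card: "z \<tau> = 0" if "card \<tau> \<noteq> 0" for \<tau>
    using that by (auto simp: z_def)
  have cycle: "koszul_d z \<tau> = 0" for \<tau>
    by (simp add: koszul_d_def z_def)
  obtain w where w: "\<And>\<sigma>. w \<sigma> \<in> M" "\<And>\<sigma>. free_homogeneous D\<^sub>0 (j - int (card \<sigma>)) (w \<sigma>)"
      "\<And>\<sigma>. card \<sigma> \<noteq> Suc 0 \<longrightarrow> w \<sigma> = 0" "\<And>\<sigma>. koszul_d w \<sigma> = z \<sigma>"
    using koszul_vanishingD[OF assms(1) mem homog card cycle] by blast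
  obtain w' where w': "\<And>\<sigma>. w' \<sigma> \<in> free_submodule B"
      "\<And>\<sigma>. free_homogeneous D (j - int (card \<sigma>)) (w' \<sigma>)"
      "\<And>\<sigma>. \<phi> (w' \<sigma>) = w \<sigma>" "\<And>\<sigma>. w \<sigma> = 0 \<longrightarrow> w' \<sigma> = 0"
    using chain_lift[OF w(1,2)] by blast
  have "\<phi> (e - koszul_d w' {}) = 0"
    using koszul_d_hom[OF module_hom, of w' "{}"] w(4)[of "{}"] by (simp add: \<phi>.diff w'(3) z_def)
  moreover have "e - koszul_d w' {} \<in> free_submodule B"
    by (intro free_module.subspace_diff[OF subspace_free_submodule] e
        koszul_d_in_subspace[OF subspace_free_submodule] w')
  ultimately have "coeff (coeff (e - koszul_d w' {}) b) 0 = 0"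
    by (intro minimal)
  moreover have "coeff (coeff (koszul_d w' {}) b) 0 = 0"
    by (simp add: coeff_koszul_d)
  ultimately show False
    by (simp add: lookup_minus e_def)
qed

end

section \<open>Minimal graded free resolutions\<close>

text \<open>Ideals are placed inside a free module of rank one, so that the augmentation and the
  differentials become covers of the same kind.\<close>

abbreviation as_vector :: "('v::finite, 'k::field) mpoly \<Rightarrow> (nat \<Rightarrow>\<^sub>0 ('v, 'k) mpoly)" where
  "as_vector \<equiv> Poly_Mapping.single 0"

lemma as_vector_mult: "as_vector (r * p) = free_scale r (as_vector p)"
  by (intro poly_mapping_eqI) (simp add: lookup_single when_def)

lemma as_vector_eq_0_iff [simp]: "as_vector p = 0 \<longleftrightarrow> p = 0"
  by (metis lookup_single_eq lookup_zero single_zero)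

lemma free_homogeneous_as_vector: "free_homogeneous (\<lambda>_. 0) d (as_vector p) \<longleftrightarrow> homogeneous d p"
  by (auto simp: free_homogeneous_def homogeneous_def lookup_single when_def)

lemma module_hom_into_as_vector:
  assumes "module_hom free_scale (*) \<epsilon>"
  shows "module_hom free_scale free_scale (\<lambda>f. as_vector (\<epsilon> f))"
proof -
  interpret \<epsilon>: module_hom free_scale "(*)" \<epsilon> by fact
  show ?thesis
    by unfold_locales (simp_all add: \<epsilon>.add \<epsilon>.scale single_add as_vector_mult)
qed

lemma unit_exp_nonzero [simp]: "unit_exp v \<noteq> 0"
  by (metis coeff_unit_exp lookup_zero of_bool_eq(2) zero_neq_one)

lemma sum_monomials: "(\<Sum>m\<in>supp p. Poly_Mapping.single m (coeff p m)) = p"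
proof (rule poly_mapping_eqI)
  fix k
  have "coeff (\<Sum>m\<in>supp p. Poly_Mapping.single m (coeff p m)) k = (\<Sum>m\<in>supp p. if m = k then coeff p k else 0)"
    unfolding lookup_sum by (intro sum.cong) (auto simp: lookup_single when_def)
  then show "coeff (\<Sum>m\<in>supp p. Poly_Mapping.single m (coeff p m)) k = coeff p k"
    by (simp add: in_keys_iff)
qed

lemma exp_eq_0_or_unit_exp_add:
  fixes m :: "'v \<Rightarrow>\<^sub>0 nat"
  obtains "m = 0" | v m' where "m = unit_exp v + m'"
proof (cases "m = 0")
  case False
  then obtain v where "coeff m v \<noteq> 0"
    by (metis poly_mapping_eqI lookup_zero)
  then have "m - unit_exp v + unit_exp v = m"
    by (intro exp_minus_plus) auto
  then show ?thesis
    using that(2)[of v "m - unit_exp v"] by (simp add: add.commute)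
qed (use that in auto)

lemma exp_add_eq_0_iff:
  fixes a b :: "'v \<Rightarrow>\<^sub>0 nat"
  shows "a + b = 0 \<longleftrightarrow> a = 0 \<and> b = 0"
  by (auto simp: poly_mapping_eq_iff fun_eq_iff lookup_add)

lemma irrelevant_ideal_iff: "p \<in> irrelevant_ideal \<longleftrightarrow> coeff p 0 = 0"
proof
  have "irrelevant_ideal \<subseteq> {p :: ('a, 'b) mpoly. coeff p 0 = 0}"
    unfolding irrelevant_ideal_def
  proof (rule self_module.span_minimal)
    show "range Var \<subseteq> {p :: ('a, 'b) mpoly. coeff p 0 = 0}"
      by (auto simp: Var_eq lookup_single)
    show "is_ideal {p :: ('a, 'b) mpoly. coeff p 0 = 0}"
    proof (rule self_module.subspaceI)
      fix r p :: "('a, 'b) mpoly" assume "p \<in> {p. coeff p 0 = 0}"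
      then have "0 \<notin> supp (r * p)"
        using keys_mult[of r p] by (auto simp: exp_add_eq_0_iff in_keys_iff dest!: subsetD sym[of 0])
      then show "r * p \<in> {p. coeff p 0 = 0}"
        by (simp add: in_keys_iff)
    qed (auto simp: lookup_add)
  qed
  then show "p \<in> irrelevant_ideal \<Longrightarrow> coeff p 0 = 0"
    by blast
next
  assume p: "coeff p 0 = 0"
  have "(\<Sum>m\<in>supp p. Poly_Mapping.single m (coeff p m)) \<in> irrelevant_ideal"
    unfolding irrelevant_ideal_def
  proof (rule self_module.span_sum)
    fix m assume "m \<in> supp p"
    with p have "m \<noteq> 0"
      by (auto simp: in_keys_iff)
    then obtain v m' where m: "m = unit_exp v + m'"
      using exp_eq_0_or_unit_exp_add by blast
    have "Poly_Mapping.single m (coeff p m) = Poly_Mapping.single m' (coeff p m) * Var v"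
      by (simp add: Var_eq mult_single m add.commute)
    then show "Poly_Mapping.single m (coeff p m) \<in> ideal_gen (range Var)"
      by (simp add: self_module.span_scale self_module.span_base)
  qed
  then show "p \<in> irrelevant_ideal"
    by (simp add: sum_monomials)
qed

section \<open>Degrees in an arbitrary minimal resolution\<close>

context minimal_graded_free_resolution
begin

text \<open>Exactness identifies the kernel with the image of the next differential. This turns
  minimality of the resolution, a condition on images, into the condition on kernels that a minimal
  cover demands.\<close>

lemma augmentation_cover:
  "minimal_cover (\<lambda>_. 0) (as_vector ` I) (B 0) (D 0) (\<lambda>f. as_vector (\<epsilon> f))"
proof (intro minimal_cover.intro graded_cover.intro minimal_cover_axioms.intro)
  show "module_hom free_scale free_scale (\<lambda>f. as_vector (\<epsilon> f))"
    by (rule module_hom_into_as_vector[OF augmentation_hom])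
  show "free_homogeneous (\<lambda>_. 0) d (as_vector (\<epsilon> f))"
    if "f \<in> free_submodule (B 0)" "free_homogeneous (D 0) d f" for f d
    using augmentation_graded[OF that] by (simp add: free_homogeneous_as_vector)
  show "(\<lambda>f. as_vector (\<epsilon> f)) ` free_submodule (B 0) = as_vector ` I"
    by (simp add: augmentation_image[symmetric] image_image)
  show "coeff (coeff f b) 0 = 0" if "f \<in> free_submodule (B 0)" "as_vector (\<epsilon> f) = 0" for f b
  proof -
    have "f \<in> \<delta> 0 ` free_submodule (B 1)"
      using that exact_0 by auto
    then show ?thesis
      using minimal[of _ 0] by (auto simp: irrelevant_ideal_iff)
  qed
qed

definition syzygies :: "nat \<Rightarrow> (nat \<Rightarrow>\<^sub>0 ('v, 'k) mpoly) set" where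
  "syzygies i = \<delta> i ` free_submodule (B (Suc i))"

lemma syzygies_0: "syzygies 0 = {f \<in> free_submodule (B 0). \<epsilon> f = 0}"
  using exact_0 by (simp add: syzygies_def)

lemma syzygies_Suc: "syzygies (Suc i) = {f \<in> free_submodule (B (Suc i)). \<delta> i f = 0}"
  using exact_Suc by (simp add: syzygies_def)

lemma differential_cover: "minimal_cover (D i) (syzygies i) (B (Suc i)) (D (Suc i)) (\<delta> i)"
proof (intro minimal_cover.intro graded_cover.intro minimal_cover_axioms.intro)
  show "module_hom free_scale free_scale (\<delta> i)"
    by (rule differential_hom)
  show "free_homogeneous (D i) d (\<delta> i f)"
    if "f \<in> free_submodule (B (Suc i))" "free_homogeneous (D (Suc i)) d f" for f d
    using that by (rule differential_graded)
  show "\<delta> i ` free_submodule (B (Suc i)) = syzygies i"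
    by (simp add: syzygies_def)
  show "coeff (coeff f b) 0 = 0" if "f \<in> free_submodule (B (Suc i))" "\<delta> i f = 0" for f b
  proof -
    have "f \<in> \<delta> (Suc i) ` free_submodule (B (Suc (Suc i)))"
      using that exact_Suc by blast
    then show ?thesis
      using minimal[of _ "Suc i"] by (auto simp: irrelevant_ideal_iff)
  qed
qed

text \<open>Each cover of the resolution costs one homological degree. The count is
  \<open>Suc t\<close> and not \<open>t\<close> because \<open>syzygies 0\<close> is already the
  kernel of the augmentation.\<close>

lemma koszul_vanishing_syzygies:
  assumes "koszul_vanishing (\<lambda>_. 0) (as_vector ` I) (Suc t + i) j"
  shows "koszul_vanishing (D t) (syzygies t) i j"
  using assms
proof (induction t arbitrary: i)
  case 0
  interpret minimal_cover "\<lambda>_. 0" "as_vector ` I" "B 0" "D 0" "\<lambda>f. as_vector (\<epsilon> f)"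
    by (rule augmentation_cover)
  show ?case
    using koszul_vanishing_kernel[of i j] 0 by (simp add: kernel_def syzygies_0)
next
  case (Suc t)
  interpret minimal_cover "D t" "syzygies t" "B (Suc t)" "D (Suc t)" "\<delta> t"
    by (rule differential_cover)
  show ?case
    using koszul_vanishing_kernel[of i j] Suc.IH[of "Suc i"] Suc.prems by (simp add: kernel_def syzygies_Suc)
qed

text \<open>The module in position 0 minimally covers \<open>I\<close>, and the one in position
  \<open>Suc t\<close> minimally covers \<open>syzygies t\<close>. A basis vector of too large a
  degree would be a generator in a degree where \<open>Tor\<^sub>0\<close> of the covered module
  vanishes.\<close>

lemma basis_degree_bound:
  assumes van: "\<And>i j. j > int i + r \<Longrightarrow> koszul_vanishing (\<lambda>_. 0) (as_vector ` I) i j" and "b \<in> B i"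
  shows "D i b \<le> int i + r"
proof (rule ccontr)
  assume "\<not> D i b \<le> int i + r"
  then have *: "koszul_vanishing (\<lambda>_. 0) (as_vector ` I) i (D i b)"
    by (intro van) simp
  show False
  proof (cases i)
    case 0
    then show ?thesis
      using minimal_cover.koszul_vanishing_generator[OF augmentation_cover] * assms(2) by blast
  next
    case (Suc t)
    then have "koszul_vanishing (D t) (syzygies t) 0 (D i b)"
      using * by (intro koszul_vanishing_syzygies) simp
    then show ?thesis
      using minimal_cover.koszul_vanishing_generator[OF differential_cover, of t] assms(2) Suc by blast
  qed
qed

end

text \<open>Exactness of the Koszul complex at its last place: a chain on the empty face is
  automatically a cycle, and a primitive lives on single vertices, where its values are the desired
  homogeneous cofactors.\<close>

lemma homogeneous_module_decomp:
  fixes x :: "nat \<Rightarrow>\<^sub>0 ('v::finite, 'k::field) mpoly"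
  assumes "x \<in> free_submodule B" "free_homogeneous D d x" "\<And>b. coeff (coeff x b) 0 = 0"
  obtains h where "\<And>v. h v \<in> free_submodule B" "\<And>v. free_homogeneous D (d - 1) (h v)"
    and "x = (\<Sum>v\<in>UNIV. free_scale (Var v) (h v))"
proof -
  define z where "z \<tau> = (if \<tau> = {} then x else 0)" for \<tau> :: "'v set"
  have cycle: "koszul_d z \<tau> = 0" for \<tau>
    by (simp add: koszul_d_def z_def)
  have mem: "z \<tau> \<in> free_submodule B" for \<tau>
    using assms(1) by (simp add: z_def free_submodule_iff)
  have homog: "free_homogeneous D (d - int (card \<tau>)) (z \<tau>)" for \<tau>
    using assms(2) by (simp add: z_def)
  have card: "card \<tau> \<noteq> 0 \<longrightarrow> z \<tau> = 0" for \<tau>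
    by (auto simp: z_def)
  have const: "coeff (coeff (z {}) b) 0 = 0" for b
    using assms(3) by (simp add: z_def)
  obtain w where w: "\<And>\<sigma>. w \<sigma> \<in> free_submodule B" "\<And>\<sigma>. free_homogeneous D (d - int (card \<sigma>)) (w \<sigma>)"
      "\<And>\<sigma>. card \<sigma> \<noteq> Suc 0 \<longrightarrow> w \<sigma> = 0" "\<And>\<sigma>. koszul_d w \<sigma> = z \<sigma>"
    using free_koszul_exact[of z B D d 0, OF cycle mem homog _ const] card by blast
  show thesis
  proof
    show "w {v} \<in> free_submodule B" for v
      by (rule w)
    show "free_homogeneous D (d - 1) (w {v})" for v
      using w(2)[of "{v}"] by simp
    show "x = (\<Sum>v\<in>UNIV. free_scale (Var v) (w {v}))"
      using w(4)[of "{}"] by (simp add: koszul_d_def z_def Var_eq koszul_sign_def)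
  qed
qed

lemma homogeneous_decomp:
  assumes "homogeneous e p" "coeff p 0 = 0"
  obtains q where "\<And>v. homogeneous (e - 1) (q v)" "p = (\<Sum>v\<in>UNIV. Var v * q v)"
proof -
  have "free_homogeneous (\<lambda>_. 0) e (as_vector p)" "as_vector p \<in> free_submodule UNIV"
    using assms by (auto simp: free_homogeneous_as_vector free_submodule_iff)
  moreover have "coeff (coeff (as_vector p) b) 0 = 0" for b
    using assms(2) by (simp add: lookup_single when_def)
  ultimately obtain h where h: "\<And>v. free_homogeneous (\<lambda>_. 0) (e - 1) (h v)"
      "as_vector p = (\<Sum>v\<in>UNIV. free_scale (Var v) (h v))"
    using homogeneous_module_decomp[of "as_vector p" UNIV "\<lambda>_. 0" e] by blast
  show thesis
  proof
    show "homogeneous (e - 1) (coeff (h v) 0)" for v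
      using h(1)[of v] by (simp add: free_homogeneous_def)
    show "p = (\<Sum>v\<in>UNIV. Var v * coeff (h v) 0)"
      using arg_cong[OF h(2), of "\<lambda>f. coeff f 0"] by (simp add: lookup_sum)
  qed
qed

text \<open>A homogeneous lift of \<open>p\<close> can have a constant term only at basis vectors of
  degree \<open>d\<close>. If there are none, the lift is a combination of multiples by variables,
  and applying \<open>\<epsilon>\<close> decomposes \<open>p\<close> inside
  \<open>I\<close>.\<close>

lemma (in minimal_graded_free_resolution) generator_degree:
  assumes "p \<in> I" "homogeneous d p"
    and indecomposable: "\<And>h. (\<And>v. h v \<in> I) \<Longrightarrow> p \<noteq> (\<Sum>v\<in>UNIV. Var v * h v)"
  shows "\<exists>b\<in>B 0. D 0 b = d"
proof (rule ccontr)
  assume no_gen: "\<not> (\<exists>b\<in>B 0. D 0 b = d)"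
  interpret \<epsilon>: module_hom free_scale "(*)" \<epsilon>
    by (rule augmentation_hom)
  interpret minimal_cover "\<lambda>_. 0" "as_vector ` I" "B 0" "D 0" "\<lambda>f. as_vector (\<epsilon> f)"
    by (rule augmentation_cover)
  obtain x where x: "x \<in> free_submodule (B 0)" "free_homogeneous (D 0) d x" "as_vector (\<epsilon> x) = as_vector p"
    using homogeneous_lift[of "as_vector p" d] assms by (auto simp: free_homogeneous_as_vector)
  have "coeff (coeff x b) 0 = 0" for b
  proof (rule ccontr)
    assume "coeff (coeff x b) 0 \<noteq> 0"
    moreover from this have "b \<in> B 0"
      using x(1) by (auto simp: free_submodule_iff)
    ultimately show False
      using no_gen free_homogeneousD[OF x(2), of b 0] by simp
  qed
  with x obtain h where h: "\<And>v. h v \<in> free_submodule (B 0)" "x = (\<Sum>v\<in>UNIV. free_scale (Var v) (h v))"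
    using homogeneous_module_decomp[of x "B 0" "D 0" d] by blast
  have "p = \<epsilon> x"
    using x(3) by (metis lookup_single_eq)
  also have "\<dots> = (\<Sum>v\<in>UNIV. Var v * \<epsilon> (h v))"
    by (simp add: h(2) \<epsilon>.sum \<epsilon>.scale)
  finally show False
    using indecomposable[of "\<lambda>v. \<epsilon> (h v)"] h(1) augmentation_image by blast
qed

section \<open>Linear algebra in a single degree\<close>

abbreviation const_scale ::
  "'k \<Rightarrow> (nat \<Rightarrow>\<^sub>0 ('v::finite, 'k::field) mpoly) \<Rightarrow> (nat \<Rightarrow>\<^sub>0 ('v, 'k) mpoly)" where
  "const_scale c \<equiv> free_scale (Poly_Mapping.single 0 c)"

interpretation coefficient_space:
  vector_space "const_scale :: 'k::field \<Rightarrow> (nat \<Rightarrow>\<^sub>0 ('v::finite, 'k) mpoly) \<Rightarrow> _"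
  by unfold_locales
    (simp_all add: free_module.scale_right_distrib free_module.scale_left_distrib single_add mult_single)

definition hom_part ::
  "(nat \<Rightarrow> int) \<Rightarrow> (nat \<Rightarrow>\<^sub>0 ('v::finite, 'k::field) mpoly) set \<Rightarrow> int \<Rightarrow> (nat \<Rightarrow>\<^sub>0 ('v, 'k) mpoly) set" where
  "hom_part D M d = {f \<in> M. free_homogeneous D d f}"

text \<open>For a graded submodule \<open>M\<close>, the degree \<open>d\<close> part of the
  irrelevant ideal times \<open>M\<close>; cofactors of degree \<open>d - 1\<close> suffice as the
  ideal is generated by variables.\<close>

definition decomposables ::
  "(nat \<Rightarrow> int) \<Rightarrow> (nat \<Rightarrow>\<^sub>0 ('v::finite, 'k::field) mpoly) set \<Rightarrow> int \<Rightarrow> (nat \<Rightarrow>\<^sub>0 ('v, 'k) mpoly) set" where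
  "decomposables D M d = {\<Sum>v\<in>UNIV. free_scale (Var v) (h v) | h. \<forall>v. h v \<in> hom_part D M (d - 1)}"

lemma decomposablesI:
  "(\<And>v. h v \<in> hom_part D M (d - 1)) \<Longrightarrow> (\<Sum>v\<in>UNIV. free_scale (Var v) (h v)) \<in> decomposables D M d"
  by (auto simp: decomposables_def)

lemma homogeneous_const: "homogeneous 0 (Poly_Mapping.single 0 c)"
  using homogeneous_single[of 0 c] by simp

lemma homogeneous_Var: "homogeneous 1 (Var v)"
  using homogeneous_single[of "unit_exp v" 1] by (simp add: Var_eq)

lemma hom_part_0: "free_module.subspace M \<Longrightarrow> 0 \<in> hom_part D M d"
  by (simp add: hom_part_def free_module.subspace_0)

lemma hom_part_add: "\<lbrakk>free_module.subspace M; f \<in> hom_part D M d; g \<in> hom_part D M d\<rbrakk> \<Longrightarrow> f + g \<in> hom_part D M d"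
  by (simp add: hom_part_def free_module.subspace_add free_homogeneous_add)

lemma hom_part_scale:
  "\<lbrakk>free_module.subspace M; homogeneous e p; f \<in> hom_part D M d\<rbrakk> \<Longrightarrow> free_scale p f \<in> hom_part D M (d + e)"
  by (simp add: hom_part_def free_module.subspace_scale free_homogeneous_scale)

lemma hom_part_const_scale:
  "\<lbrakk>free_module.subspace M; f \<in> hom_part D M d\<rbrakk> \<Longrightarrow> const_scale c f \<in> hom_part D M d"
  using hom_part_scale[OF _ homogeneous_const] by force

lemma hom_part_sum:
  "\<lbrakk>free_module.subspace M; \<And>x. x \<in> X \<Longrightarrow> f x \<in> hom_part D M d\<rbrakk> \<Longrightarrow> sum f X \<in> hom_part D M d"
  by (simp add: hom_part_def free_module.subspace_sum free_homogeneous_sum)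

lemma decomposables_subset: "free_module.subspace M \<Longrightarrow> decomposables D M d \<subseteq> hom_part D M d"
proof
  fix f assume M: "free_module.subspace M" and "f \<in> decomposables D M d"
  then obtain h where h: "\<And>v. h v \<in> hom_part D M (d - 1)" "f = (\<Sum>v\<in>UNIV. free_scale (Var v) (h v))"
    by (auto simp: decomposables_def)
  show "f \<in> hom_part D M d"
    unfolding h(2) using hom_part_scale[OF M homogeneous_Var h(1)]
    by (intro hom_part_sum[OF M]) simp
qed

lemma subspace_decomposables:
  assumes "free_module.subspace M"
  shows "coefficient_space.subspace (decomposables D M d)"
proof (rule coefficient_space.subspaceI)
  show "0 \<in> decomposables D M d"
    unfolding decomposables_def using hom_part_0[OF assms]
    by (auto intro!: exI[of _ "\<lambda>_. 0"])
next
  fix f g assume "f \<in> decomposables D M d" "g \<in> decomposables D M d"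
  then obtain h k where h: "\<And>v. h v \<in> hom_part D M (d - 1)" "f = (\<Sum>v\<in>UNIV. free_scale (Var v) (h v))"
    and k: "\<And>v. k v \<in> hom_part D M (d - 1)" "g = (\<Sum>v\<in>UNIV. free_scale (Var v) (k v))"
    by (auto simp: decomposables_def)
  have "f + g = (\<Sum>v\<in>UNIV. free_scale (Var v) (h v + k v))"
    by (simp add: h(2) k(2) free_module.scale_right_distrib sum.distrib)
  also have "\<dots> \<in> decomposables D M d"
    by (intro decomposablesI hom_part_add[OF assms] h k)
  finally show "f + g \<in> decomposables D M d" .
next
  fix c f assume "f \<in> decomposables D M d"
  then obtain h where h: "\<And>v. h v \<in> hom_part D M (d - 1)" "f = (\<Sum>v\<in>UNIV. free_scale (Var v) (h v))"
    by (auto simp: decomposables_def)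
  have "const_scale c f = (\<Sum>v\<in>UNIV. free_scale (Var v) (const_scale c (h v)))"
    by (simp add: h(2) free_module.scale_sum_right mult.commute)
  also have "\<dots> \<in> decomposables D M d"
    by (intro decomposablesI hom_part_const_scale[OF assms] h)
  finally show "const_scale c f \<in> decomposables D M d" .
qed

text \<open>The invariant of the iterated construction. Nonnegative degrees give the induction on
  the degree a starting point, and finiteness in each degree makes every graded piece
  finite-dimensional.\<close>

definition locally_finite_basis :: "nat set \<Rightarrow> (nat \<Rightarrow> int) \<Rightarrow> bool" where
  "locally_finite_basis B D \<longleftrightarrow> (\<forall>b\<in>B. 0 \<le> D b) \<and> (\<forall>d. finite {b \<in> B. D b = d})"

lemma finite_monom_degree: "finite {m :: 'v::finite \<Rightarrow>\<^sub>0 nat. monom_degree m = n}"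
proof (induction n)
  case 0
  show ?case
    by (simp add: monom_degree_eq_0_iff)
next
  case (Suc n)
  have "{m :: 'v \<Rightarrow>\<^sub>0 nat. monom_degree m = Suc n} \<subseteq> (\<Union>v. (+) (unit_exp v) ` {m. monom_degree m = n})"
  proof
    fix m :: "'v \<Rightarrow>\<^sub>0 nat" assume m: "m \<in> {m. monom_degree m = Suc n}"
    show "m \<in> (\<Union>v. (+) (unit_exp v) ` {m. monom_degree m = n})"
    proof (rule exp_eq_0_or_unit_exp_add[of m])
      fix v m' assume "m = unit_exp v + m'"
      with m show ?thesis
        by (auto simp: monom_degree_add)
    qed (use m in auto)
  qed
  with Suc show ?case
    by (meson finite_UN_I finite_imageI finite_UNIV finite_subset)
qed

lemma hom_part_finite_dim:
  fixes M :: "(nat \<Rightarrow>\<^sub>0 ('v::finite, 'k::field) mpoly) set"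
  assumes B: "locally_finite_basis B D" and M: "M \<subseteq> free_submodule B"
  obtains T where "finite T" "hom_part D M d \<subseteq> coefficient_space.span T"
proof
  define X where "X = (\<Union>e\<in>{0..d}. {b \<in> B. D b = e} \<times> {m :: 'v \<Rightarrow>\<^sub>0 nat. monom_degree m = nat (d - e)})"
  define t :: "nat \<times> ('v \<Rightarrow>\<^sub>0 nat) \<Rightarrow> (nat \<Rightarrow>\<^sub>0 ('v, 'k) mpoly)"
    where "t = (\<lambda>(b, m). Poly_Mapping.single b (Poly_Mapping.single m 1))"
  have "finite X"
    using B by (auto simp: X_def locally_finite_basis_def finite_monom_degree)
  then show "finite (t ` X)"
    by simp
  show "hom_part D M d \<subseteq> coefficient_space.span (t ` X)"
  proof
    fix f assume f: "f \<in> hom_part D M d"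
    have "f = (\<Sum>b\<in>supp f. Poly_Mapping.single b (\<Sum>m\<in>supp (coeff f b). Poly_Mapping.single m (coeff (coeff f b) m)))"
      by (simp add: sum_monomials)
    also have "\<dots> = (\<Sum>b\<in>supp f. \<Sum>m\<in>supp (coeff f b). const_scale (coeff (coeff f b) m) (t (b, m)))"
    proof (rule sum.cong[OF refl])
      fix b :: nat
      have "Poly_Mapping.single b (sum F Y) = (\<Sum>y\<in>Y. Poly_Mapping.single b (F y))"
        for F :: "('v \<Rightarrow>\<^sub>0 nat) \<Rightarrow> ('v, 'k) mpoly" and Y
        by (induction Y rule: infinite_finite_induct) (auto simp: single_add)
      moreover have "Poly_Mapping.single b (Poly_Mapping.single m c) = const_scale c (t (b, m))" for m c
        by (intro poly_mapping_eqI) (auto simp: t_def lookup_single when_def mult_single)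
      ultimately show "Poly_Mapping.single b (\<Sum>m\<in>supp (coeff f b). Poly_Mapping.single m (coeff (coeff f b) m)) =
          (\<Sum>m\<in>supp (coeff f b). const_scale (coeff (coeff f b) m) (t (b, m)))"
        by simp
    qed
    also have "\<dots> \<in> coefficient_space.span (t ` X)"
    proof (intro coefficient_space.span_sum coefficient_space.span_scale coefficient_space.span_base imageI)
      fix b m assume b: "b \<in> supp f" and m: "m \<in> supp (coeff f b)"
      have "b \<in> B"
        using f b M by (auto simp: hom_part_def free_submodule_def)
      moreover have "int (monom_degree m) + D b = d"
        using f m by (auto simp: hom_part_def in_keys_iff dest: free_homogeneousD)
      moreover have "0 \<le> D b"
        using B \<open>b \<in> B\<close> by (simp add: locally_finite_basis_def)
      ultimately show "(b, m) \<in> X"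
        by (auto simp: X_def intro!: bexI[of _ "D b"])
    qed
    finally show "f \<in> coefficient_space.span (t ` X)" .
  qed
qed

text \<open>A basis of a complement of the decomposable elements of degree \<open>d\<close>.\<close>

lemma minimal_generators_of_degree:
  fixes M :: "(nat \<Rightarrow>\<^sub>0 ('v::finite, 'k::field) mpoly) set"
  assumes M: "graded_submodule B D M" and B: "locally_finite_basis B D"
  shows "\<exists>(n :: nat) g. (\<forall>i<n. g i \<in> hom_part D M d) \<and>
    (\<forall>f\<in>hom_part D M d. \<exists>c. \<exists>w\<in>decomposables D M d. f = w + (\<Sum>i<n. const_scale (c i) (g i))) \<and>
    (\<forall>c. (\<Sum>i<n. const_scale (c i) (g i)) \<in> decomposables D M d \<longrightarrow> (\<forall>i<n. c i = 0))"
proof -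
  let ?W = "decomposables D M d" and ?H = "hom_part D M d"
  have sub: "free_module.subspace M" "M \<subseteq> free_submodule B"
    using M by (auto simp: graded_submodule_def)
  obtain C where C: "C \<subseteq> ?W" "coefficient_space.independent C" "?W \<subseteq> coefficient_space.span C"
    using coefficient_space.maximal_independent_subset[of ?W] by blast
  then have "C \<subseteq> ?H"
    using decomposables_subset[OF sub(1)] by blast
  then obtain E where E: "C \<subseteq> E" "E \<subseteq> ?H" "coefficient_space.independent E" "?H \<subseteq> coefficient_space.span E"
    using coefficient_space.maximal_independent_subset_extend[OF _ C(2)] by blast
  obtain T where T: "finite T" "?H \<subseteq> coefficient_space.span T"
    using hom_part_finite_dim[OF B sub(2)] by blast
  have finE: "finite E"
    using coefficient_space.independent_span_bound[OF T(1) E(3)] E(2) T(2) by blast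
  with E(1) have finC: "finite C"
    by (rule finite_subset)
  have split_E: "(\<Sum>e\<in>E. F e) = (\<Sum>e\<in>C. F e) + (\<Sum>e\<in>E - C. F e)" for F :: "_ \<Rightarrow> (nat \<Rightarrow>\<^sub>0 ('v, 'k) mpoly)"
    using sum.subset_diff[OF E(1) finE, of F] by (simp add: add.commute)
  obtain g where g: "bij_betw g {..<card (E - C)} (E - C)"
    using finE ex_bij_betw_nat_finite[of "E - C"] by (auto simp: lessThan_atLeast0)
  have reindex: "(\<Sum>i<card (E - C). const_scale (c (g i)) (g i)) = (\<Sum>e\<in>E - C. const_scale (c e) e)" for c
    using sum.reindex_bij_betw[OF g] .
  show ?thesis
  proof (intro exI[of _ "card (E - C)"] exI[of _ g] conjI allI impI ballI)
    show "g i \<in> ?H" if "i < card (E - C)" for i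
      using g that E(2) by (auto simp: bij_betw_def)
    show "\<exists>c. \<exists>w\<in>?W. f = w + (\<Sum>i<card (E - C). const_scale (c i) (g i))" if "f \<in> ?H" for f
    proof -
      have "f \<in> range (\<lambda>u. \<Sum>e\<in>E. const_scale (u e) e)"
        using that E(4) coefficient_space.span_finite[OF finE] by blast
      then obtain u where u: "f = (\<Sum>e\<in>E. const_scale (u e) e)"
        by blast
      have "(\<Sum>e\<in>C. const_scale (u e) e) \<in> ?W"
        using C(1) subspace_decomposables[OF sub(1)]
        by (intro coefficient_space.subspace_sum coefficient_space.subspace_scale) auto
      moreover have "f = (\<Sum>e\<in>C. const_scale (u e) e) + (\<Sum>i<card (E - C). const_scale (u (g i)) (g i))"
        unfolding u split_E reindex ..
      ultimately show ?thesis
        by (intro exI[of _ "\<lambda>i. u (g i)"] bexI)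
    qed
    show "c i = 0" if W: "(\<Sum>i<card (E - C). const_scale (c i) (g i)) \<in> ?W" and i: "i < card (E - C)" for c i
    proof (rule ccontr)
      assume "c i \<noteq> 0"
      \<comment> \<open>The inverse of the enumeration \<open>g\<close>: with it, the relation
        between the \<open>g k\<close> and the elements of \<open>C\<close> becomes a single linear
        relation over the independent set \<open>E\<close>.\<close>
      define h where "h = the_inv_into {..<card (E - C)} g"
      have h: "h (g k) = k" if "k < card (E - C)" for k
        using g that by (auto simp: h_def bij_betw_def the_inv_into_f_f)
      have "(\<Sum>k<card (E - C). const_scale (c k) (g k)) \<in> range (\<lambda>u. \<Sum>e\<in>C. const_scale (u e) e)"
        using W C(3) coefficient_space.span_finite[OF finC] by blast
      then obtain u where u: "(\<Sum>k<card (E - C). const_scale (c k) (g k)) = (\<Sum>e\<in>C. const_scale (u e) e)"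
        by blast
      have "(\<Sum>k<card (E - C). const_scale (c k) (g k)) = (\<Sum>e\<in>E - C. const_scale (c (h e)) e)"
        using reindex[of "\<lambda>e. c (h e)"] by (simp add: h)
      with u have "(\<Sum>e\<in>E. const_scale (if e \<in> C then - u e else c (h e)) e) = 0"
        by (simp add: split_E sum_negf single_uminus free_module.scale_minus_left)
      moreover have "g i \<in> E - C"
        using g i by (auto simp: bij_betw_def)
      ultimately have "\<exists>u. (\<exists>v\<in>E. u v \<noteq> 0) \<and> (\<Sum>v\<in>E. const_scale (u v) v) = 0"
        using \<open>c i \<noteq> 0\<close> h[OF i]
        by (intro exI[of _ "\<lambda>e. if e \<in> C then - u e else c (h e)"] conjI bexI[of _ "g i"]) auto
      then show False
        using E(3) coefficient_space.dependent_finite[OF finE] by blast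
    qed
  qed
qed

section \<open>Existence of minimal covers and resolutions\<close>

definition free_extension ::
  "(nat \<Rightarrow> (nat \<Rightarrow>\<^sub>0 ('v::finite, 'k::field) mpoly)) \<Rightarrow> (nat \<Rightarrow>\<^sub>0 ('v, 'k) mpoly) \<Rightarrow> (nat \<Rightarrow>\<^sub>0 ('v, 'k) mpoly)" where
  "free_extension g f = (\<Sum>b\<in>supp f. free_scale (coeff f b) (g b))"

lemma free_extension_superset:
  "\<lbrakk>finite S; supp f \<subseteq> S\<rbrakk> \<Longrightarrow> free_extension g f = (\<Sum>b\<in>S. free_scale (coeff f b) (g b))"
  unfolding free_extension_def by (rule sum.mono_neutral_left) (auto simp: in_keys_iff)

lemma module_hom_free_extension: "module_hom free_scale free_scale (free_extension g)"
proof unfold_locales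
  fix f h :: "nat \<Rightarrow>\<^sub>0 ('a, 'b) mpoly" and r
  have "supp (f + h) \<subseteq> supp f \<union> supp h" "supp f \<subseteq> supp f \<union> supp h" "supp h \<subseteq> supp f \<union> supp h"
    using keys_add[of f h] by auto
  then show "free_extension g (f + h) = free_extension g f + free_extension g h"
    by (simp add: free_extension_superset[where S = "supp f \<union> supp h"] lookup_add
        free_module.scale_left_distrib sum.distrib)
  have "supp (free_scale r f) \<subseteq> supp f"
    by (auto simp: in_keys_iff)
  then show "free_extension g (free_scale r f) = free_scale r (free_extension g f)"
    by (simp add: free_extension_superset[where S = "supp f"] free_module.scale_sum_right)
qed

lemma free_extension_basis [simp]: "free_extension g (Poly_Mapping.single b 1) = g b"
  by (simp add: free_extension_def)

text \<open>A graded Nakayama argument. Representatives of a basis modulo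
  \<open>decomposables\<close>, taken in every degree, generate \<open>M\<close> by induction on the
  degree, and their independence modulo \<open>decomposables\<close> forbids constant terms in
  relations.\<close>

lemma exists_minimal_cover:
  fixes M :: "(nat \<Rightarrow>\<^sub>0 ('v::finite, 'k::field) mpoly) set"
  assumes M: "graded_submodule B\<^sub>0 D\<^sub>0 M" and B\<^sub>0: "locally_finite_basis B\<^sub>0 D\<^sub>0"
  shows "\<exists>B D \<phi>. minimal_cover D\<^sub>0 M B D \<phi> \<and> locally_finite_basis B D"
proof -
  have sub: "free_module.subspace M" "M \<subseteq> free_submodule B\<^sub>0"
    and comp: "\<And>f d. f \<in> M \<Longrightarrow> free_hom_comp D\<^sub>0 d f \<in> M"
    using M by (auto simp: graded_submodule_def)
  let ?H = "hom_part D\<^sub>0 M" and ?W = "decomposables D\<^sub>0 M"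
  define gens where "gens d n g \<longleftrightarrow> (\<forall>i<n. g i \<in> ?H d) \<and>
    (\<forall>f\<in>?H d. \<exists>c. \<exists>w\<in>?W d. f = w + (\<Sum>i<n. const_scale (c i) (g i))) \<and>
    (\<forall>c. (\<Sum>i<n. const_scale (c i) (g i)) \<in> ?W d \<longrightarrow> (\<forall>i<n. c i = 0))"
    for d and n :: nat and g
  have "\<forall>d. \<exists>n g. gens d n g"
    unfolding gens_def using minimal_generators_of_degree[OF M B\<^sub>0] by blast
  then obtain n g where ng: "\<And>d. gens d (n d) (g d)"
    by metis
  have g: "g d i \<in> ?H d" if "i < n d" for d i
    using ng[of d] that by (simp add: gens_def)
  have gen: "\<exists>c. \<exists>w\<in>?W d. f = w + (\<Sum>i<n d. const_scale (c i) (g d i))" if "f \<in> ?H d" for d f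
    using ng[of d] that unfolding gens_def by blast
  have indep: "c i = 0" if "(\<Sum>i<n d. const_scale (c i) (g d i)) \<in> ?W d" "i < n d" for d c i
    using ng[of d] that unfolding gens_def by blast
  \<comment> \<open>A basis vector is the code of a pair: its degree and its number among the
    generators of that degree. Natural numbers suffice as degrees because the pieces of
    \<open>M\<close> in negative degrees are zero.\<close>
  define D where "D b = int (fst (prod_decode b))" for b
  define G where "G b = g (D b) (snd (prod_decode b))" for b
  define B where "B = {b. snd (prod_decode b) < n (D b)}"
  define \<phi> where "\<phi> = free_extension G"
  have G: "G b \<in> ?H (D b)" if "b \<in> B" for b
    using that g by (simp add: G_def B_def)
  have enc: "D (prod_encode (k, i)) = int k" "G (prod_encode (k, i)) = g (int k) i"
      "prod_encode (k, i) \<in> B \<longleftrightarrow> i < n (int k)" for k i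
    by (simp_all add: D_def G_def B_def)
  have "{b \<in> B. D b = d} \<subseteq> prod_encode ` ({nat d} \<times> {..<n d})" for d
  proof
    fix b assume "b \<in> {b \<in> B. D b = d}"
    then have "prod_decode b \<in> {nat d} \<times> {..<n d}"
      by (auto simp: B_def D_def mem_Times_iff)
    then show "b \<in> prod_encode ` ({nat d} \<times> {..<n d})"
      by (metis image_eqI prod_decode_inverse)
  qed
  then have "finite {b \<in> B. D b = d}" for d
    by (rule finite_subset) simp
  then have fin: "locally_finite_basis B D"
    by (simp add: locally_finite_basis_def D_def)
  interpret \<phi>: module_hom free_scale free_scale \<phi>
    unfolding \<phi>_def by (rule module_hom_free_extension)
  have "graded_cover D\<^sub>0 M B D \<phi>"
  proof
    show "free_homogeneous D\<^sub>0 d (\<phi> f)" if "f \<in> free_submodule B" "free_homogeneous D d f" for f d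
      unfolding \<phi>_def free_extension_def
    proof (rule free_homogeneous_sum)
      fix b assume "b \<in> supp f"
      then have "b \<in> B"
        using that(1) by (auto simp: free_submodule_def)
      then have "free_homogeneous D\<^sub>0 (D b + (d - D b)) (free_scale (coeff f b) (G b))"
        using that(2) G[of b] by (intro free_homogeneous_scale) (auto simp: free_homogeneous_def hom_part_def)
      then show "free_homogeneous D\<^sub>0 d (free_scale (coeff f b) (G b))"
        by simp
    qed
    have sub_image: "free_module.subspace (\<phi> ` free_submodule B)"
      by (intro \<phi>.subspace_image subspace_free_submodule)
    have basis_image: "g (int k) i \<in> \<phi> ` free_submodule B" if "i < n (int k)" for k i
    proof -
      have "Poly_Mapping.single (prod_encode (k, i)) 1 \<in> free_submodule B"
        using that by (simp add: free_submodule_def enc)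
      then show ?thesis
        by (metis \<phi>_def enc(2) free_extension_basis image_eqI)
    qed
    have negative: "?H d \<subseteq> {0}" if "d < 0" for d
    proof
      fix f assume f: "f \<in> ?H d"
      have "coeff (coeff f b) m = 0" for b m
      proof (rule ccontr)
        assume nz: "coeff (coeff f b) m \<noteq> 0"
        moreover have "f \<in> free_submodule B\<^sub>0"
          using f sub(2) by (auto simp: hom_part_def)
        ultimately have "b \<in> B\<^sub>0"
          by (auto simp: free_submodule_iff)
        moreover have "int (monom_degree m) + D\<^sub>0 b = d"
          using f nz by (auto simp: hom_part_def dest!: free_homogeneousD)
        ultimately show False
          using B\<^sub>0 \<open>d < 0\<close> by (auto simp: locally_finite_basis_def)
      qed
      then show "f \<in> {0}"
        by (auto intro!: poly_mapping_eqI)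
    qed
    have step: "?H (int k) \<subseteq> \<phi> ` free_submodule B" if "?H (int k - 1) \<subseteq> \<phi> ` free_submodule B" for k
    proof
      fix f assume "f \<in> ?H (int k)"
      then obtain c w where f: "w \<in> ?W (int k)" "f = w + (\<Sum>i<n (int k). const_scale (c i) (g (int k) i))"
        using gen by blast
      have "w \<in> \<phi> ` free_submodule B"
        using f(1) that
        by (auto simp: decomposables_def intro!: free_module.subspace_sum[OF sub_image]
            free_module.subspace_scale[OF sub_image])
      then show "f \<in> \<phi> ` free_submodule B"
        unfolding f(2) using basis_image
        by (intro free_module.subspace_add[OF sub_image] free_module.subspace_sum[OF sub_image]
            free_module.subspace_scale[OF sub_image]) auto
    qed
    have zero_mem: "0 \<in> \<phi> ` free_submodule B"
      by (rule free_module.subspace_0[OF sub_image])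
    have H: "?H (int k) \<subseteq> \<phi> ` free_submodule B" for k
    proof (induction k)
      case 0
      show ?case
        using negative[of "int 0 - 1"] zero_mem by (intro step) auto
    next
      case (Suc k)
      then show ?case
        by (intro step) simp
    qed
    show "\<phi> ` free_submodule B = M"
    proof
      show "\<phi> ` free_submodule B \<subseteq> M"
      proof (rule image_subsetI)
        fix f :: "nat \<Rightarrow>\<^sub>0 ('v, 'k) mpoly" assume f: "f \<in> free_submodule B"
        show "\<phi> f \<in> M"
          unfolding \<phi>_def free_extension_def
          using f G by (intro free_module.subspace_sum[OF sub(1)] free_module.subspace_scale[OF sub(1)])
            (auto simp: free_submodule_def hom_part_def)
      qed
      show "M \<subseteq> \<phi> ` free_submodule B"
      proof
        fix f assume f: "f \<in> M"
        have "free_hom_comp D\<^sub>0 d f \<in> \<phi> ` free_submodule B" for d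
        proof -
          have "free_hom_comp D\<^sub>0 d f \<in> ?H d"
            using comp[OF f] by (simp add: hom_part_def)
          then show ?thesis
            using negative[of d] zero_mem H[of "nat d"] by (cases "d < 0") auto
        qed
        then have "(\<Sum>d\<in>free_degrees D\<^sub>0 f. free_hom_comp D\<^sub>0 d f) \<in> \<phi> ` free_submodule B"
          by (intro free_module.subspace_sum[OF sub_image])
        then show "f \<in> \<phi> ` free_submodule B"
          by (simp add: sum_free_hom_comp)
      qed
    qed
  qed
  then interpret graded_cover D\<^sub>0 M B D \<phi> .
  have "coeff (coeff f b) 0 = 0" if f: "f \<in> free_submodule B" "\<phi> f = 0" for f b
  proof (rule ccontr)
    assume nz: "coeff (coeff f b) 0 \<noteq> 0"
    then have "b \<in> B"
      using f(1) by (auto simp: free_submodule_iff)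
    define k i where "k = fst (prod_decode b)" and "i = snd (prod_decode b)"
    have b: "b = prod_encode (k, i)" "D b = int k"
      by (simp_all add: k_def i_def D_def)
    have i: "i < n (int k)"
      using \<open>b \<in> B\<close> by (simp add: b enc)
    \<comment> \<open>In the component of degree \<open>k\<close>, the degree of \<open>b\<close>,
      the coefficients at basis vectors of degree \<open>k\<close> are scalars, while all other
      coefficients lack a constant term and hence contribute decomposable elements.\<close>
    define f' where "f' = free_hom_comp D (int k) f"
    have f': "f' \<in> free_submodule B" "\<phi> f' = 0"
      using free_hom_comp_image[OF f(1), of "int k"] f
      by (simp_all add: f'_def free_hom_comp_in_free_submodule)
    have f'_coeff: "homogeneous (int k - D b') (coeff f' b')" for b'
      using free_homogeneous_hom_comp[of D "int k" f] by (simp add: f'_def free_homogeneous_def)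
    \<comment> \<open>All basis vectors of degree \<open>k\<close>, including those at which
      \<open>f'\<close> vanishes, so that the sum has the shape to which \<open>indep\<close>
      applies.\<close>
    define S where "S = (\<lambda>l. prod_encode (k, l)) ` {..<n (int k)}"
    have inj: "inj_on (\<lambda>l. prod_encode (k, l)) {..<n (int k)}"
      by (auto simp: inj_on_def)
    have "0 = (\<Sum>b'\<in>S \<union> supp f'. free_scale (coeff f' b') (G b'))"
      using f'(2) free_extension_superset[of "S \<union> supp f'" f' G] by (simp add: \<phi>_def S_def)
    also have "\<dots> = (\<Sum>b'\<in>S. free_scale (coeff f' b') (G b')) + (\<Sum>b'\<in>supp f' - S. free_scale (coeff f' b') (G b'))"
      by (subst Un_Diff_cancel[symmetric], rule sum.union_disjoint) (auto simp: S_def)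
    finally have "(\<Sum>b'\<in>S. free_scale (coeff f' b') (G b')) = - (\<Sum>b'\<in>supp f' - S. free_scale (coeff f' b') (G b'))"
      by (simp add: eq_neg_iff_add_eq_0)
    also have "\<dots> = (\<Sum>b'\<in>supp f' - S. const_scale (- 1) (free_scale (coeff f' b') (G b')))"
      by (simp add: sum_negf[symmetric] single_uminus)
    also have "\<dots> \<in> ?W (int k)"
    proof (intro coefficient_space.subspace_sum[OF subspace_decomposables[OF sub(1)]]
        coefficient_space.subspace_scale[OF subspace_decomposables[OF sub(1)]])
      fix b' assume b': "b' \<in> supp f' - S"
      then have "b' \<in> B"
        using f'(1) by (auto simp: free_submodule_def)
      have "D b' \<noteq> int k"
      proof
        assume "D b' = int k"
        then have "b' = prod_encode (k, snd (prod_decode b'))" "snd (prod_decode b') < n (int k)"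
          using \<open>b' \<in> B\<close> by (auto simp: D_def B_def)
        with b' show False
          by (auto simp: S_def)
      qed
      then have "coeff (coeff f' b') 0 = 0"
        using f'_coeff[of b'] by (force simp: homogeneous_def in_keys_iff)
      with f'_coeff[of b'] obtain q where q: "\<And>v. homogeneous (int k - D b' - 1) (q v)"
          "coeff f' b' = (\<Sum>v\<in>UNIV. Var v * q v)"
        using homogeneous_decomp by blast
      have "free_scale (coeff f' b') (G b') = (\<Sum>v\<in>UNIV. free_scale (Var v) (free_scale (q v) (G b')))"
        by (simp add: q(2) free_module.scale_sum_left)
      also have "\<dots> \<in> ?W (int k)"
      proof (rule decomposablesI)
        show "free_scale (q v) (G b') \<in> ?H (int k - 1)" for v
          using hom_part_scale[OF sub(1) q(1)[of v] G[OF \<open>b' \<in> B\<close>]] by simp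
      qed
      finally show "free_scale (coeff f' b') (G b') \<in> ?W (int k)" .
    qed
    also have "(\<Sum>b'\<in>S. free_scale (coeff f' b') (G b')) =
        (\<Sum>l<n (int k). const_scale (coeff (coeff f' (prod_encode (k, l))) 0) (g (int k) l))"
      unfolding S_def sum.reindex[OF inj] o_def enc
    proof (rule sum.cong[OF refl])
      fix l
      have "homogeneous 0 (coeff f' (prod_encode (k, l)))"
        using f'_coeff[of "prod_encode (k, l)"] by (simp add: enc)
      then have "coeff f' (prod_encode (k, l)) = Poly_Mapping.single 0 (coeff (coeff f' (prod_encode (k, l))) 0)"
        by (intro poly_mapping_eqI)
          (auto simp: lookup_single when_def homogeneous_def in_keys_iff monom_degree_eq_0_iff)
      then show "free_scale (coeff f' (prod_encode (k, l))) (g (int k) l) =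
          const_scale (coeff (coeff f' (prod_encode (k, l))) 0) (g (int k) l)"
        by simp
    qed
    finally have "coeff (coeff f' b) 0 = 0"
      unfolding b(1) by (rule indep[OF _ i])
    with nz b show False
      by (simp add: f'_def)
  qed
  then have "minimal_cover D\<^sub>0 M B D \<phi>"
    by unfold_locales
  with fin show ?thesis
    by blast
qed

lemma graded_submodule_as_vector:
  fixes I :: "('v::finite, 'k::field) mpoly set"
  assumes "is_ideal I" "\<And>f d. f \<in> I \<Longrightarrow> hom_comp d f \<in> I"
  shows "graded_submodule {0} (\<lambda>_. 0) (as_vector ` I)"
  unfolding graded_submodule_def
proof (intro conjI)
  show "free_module.subspace (as_vector ` I)"
  proof (rule free_module.subspaceI)
    show "0 \<in> as_vector ` I"
      using self_module.subspace_0[OF assms(1)] by (metis image_eqI single_zero)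
    show "f + g \<in> as_vector ` I" if "f \<in> as_vector ` I" "g \<in> as_vector ` I" for f g
      using that self_module.subspace_add[OF assms(1)] by (auto simp: single_add[symmetric])
    show "free_scale r f \<in> as_vector ` I" if "f \<in> as_vector ` I" for r f
      using that self_module.subspace_scale[OF assms(1)] by (auto simp: as_vector_mult[symmetric])
  qed
  show "as_vector ` I \<subseteq> free_submodule {0}"
    by (auto simp: free_submodule_iff lookup_single)
  have "free_hom_comp (\<lambda>_. 0) d (as_vector p) = as_vector (hom_comp d p)" for d and p :: "('v, 'k) mpoly"
    by (intro poly_mapping_eqI) (simp add: lookup_single when_def)
  then show "\<forall>f\<in>as_vector ` I. \<forall>d. free_hom_comp (\<lambda>_. 0) d f \<in> as_vector ` I"
    using assms(2) by auto
qed

text \<open>Dependent choice on triples of a basis, its degrees and a submodule to be covered next.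
  Entry 0 is the polynomial ring itself with \<open>I\<close> inside it, so the module in position
  \<open>i\<close> of the resolution is found in entry \<open>Suc i\<close>.\<close>

lemma exists_minimal_graded_free_resolution:
  fixes I :: "('v::finite, 'k::field) mpoly set"
  assumes "is_ideal I" "\<And>f d. f \<in> I \<Longrightarrow> hom_comp d f \<in> I"
  shows "\<exists>B D \<epsilon> \<delta>. minimal_graded_free_resolution I B D \<epsilon> \<delta>"
proof -
  define good :: "nat set \<times> (nat \<Rightarrow> int) \<times> (nat \<Rightarrow>\<^sub>0 ('v, 'k) mpoly) set \<Rightarrow> bool"
    where "good = (\<lambda>(B, D, M). graded_submodule B D M \<and> locally_finite_basis B D)"
  define cover where "cover = (\<lambda>(B\<^sub>0 :: nat set, D\<^sub>0, M) (B, D, K) \<phi>.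
      minimal_cover D\<^sub>0 M B D \<phi> \<and> K = {f \<in> free_submodule B. \<phi> f = (0 :: nat \<Rightarrow>\<^sub>0 ('v, 'k) mpoly)})"
  define start where "start = ({0 :: nat}, (\<lambda>_ :: nat. 0 :: int), as_vector ` I)"
  have "good start"
    using graded_submodule_as_vector[OF assms] by (simp add: good_def start_def locally_finite_basis_def)
  have next_step: "\<exists>y. good y \<and> (\<exists>\<phi>. cover x y \<phi>)" if x: "good x" for x
  proof -
    obtain B\<^sub>0 D\<^sub>0 M where x_eq: "x = (B\<^sub>0, D\<^sub>0, M)"
      by (cases x)
    then obtain B D \<phi> where c: "minimal_cover D\<^sub>0 M B D \<phi>" "locally_finite_basis B D"
      using exists_minimal_cover[of B\<^sub>0 D\<^sub>0 M] x by (auto simp: good_def)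
    interpret minimal_cover D\<^sub>0 M B D \<phi>
      by (fact c)
    have "good (B, D, kernel)"
      using graded_submodule_kernel c(2) by (simp add: good_def)
    moreover have "cover x (B, D, kernel) \<phi>"
      using c(1) by (simp add: cover_def x_eq kernel_def)
    ultimately show ?thesis
      by blast
  qed
  have "\<exists>s. \<forall>n. (good (s n) \<and> (n = 0 \<longrightarrow> s n = start)) \<and> (\<exists>\<phi>. cover (s n) (s (Suc n)) \<phi>)"
  proof (rule dependent_nat_choice)
    show "\<exists>x. good x \<and> (0 = (0 :: nat) \<longrightarrow> x = start)"
      using \<open>good start\<close> by blast
    show "\<exists>y. (good y \<and> (Suc n = 0 \<longrightarrow> y = start)) \<and> (\<exists>\<phi>. cover x y \<phi>)"
      if "good x \<and> (n = 0 \<longrightarrow> x = start)" for x n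
      using next_step that by blast
  qed
  then obtain s where s: "s 0 = start" "\<And>n. \<exists>\<phi>. cover (s n) (s (Suc n)) \<phi>"
    by blast
  then obtain \<phi> where \<phi>: "\<And>n. cover (s n) (s (Suc n)) (\<phi> n)"
    by metis
  define B where "B n = fst (s n)" for n
  define D where "D n = fst (snd (s n))" for n
  define M where "M n = snd (snd (s n))" for n
  have zero: "B 0 = {0}" "D 0 = (\<lambda>_. 0)" "M 0 = as_vector ` I"
    by (simp_all add: B_def D_def M_def s start_def)
  have cov: "minimal_cover (D n) (M n) (B (Suc n)) (D (Suc n)) (\<phi> n)"
    and M_Suc: "M (Suc n) = {f \<in> free_submodule (B (Suc n)). \<phi> n f = 0}" for n
    using \<phi>[of n] by (auto simp: cover_def B_def D_def M_def split: prod.splits)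
  have image: "\<phi> n ` free_submodule (B (Suc n)) = M n" for n
    using minimal_cover.axioms(1)[OF cov] by (rule graded_cover.image)
  have hom: "module_hom free_scale free_scale (\<phi> n)" for n
    using minimal_cover.axioms(1)[OF cov] by (rule graded_cover.module_hom)
  have graded: "free_homogeneous (D n) d (\<phi> n f)"
    if "f \<in> free_submodule (B (Suc n))" "free_homogeneous (D (Suc n)) d f" for n d f
    using minimal_cover.axioms(1)[OF cov] that by (rule graded_cover.graded)
  define \<epsilon> where "\<epsilon> f = coeff (\<phi> 0 f) 0" for f
  have \<epsilon>: "\<phi> 0 f = as_vector (\<epsilon> f)" "\<epsilon> f \<in> I" if "f \<in> free_submodule (B 1)" for f
  proof -
    have "\<phi> 0 f \<in> as_vector ` I"
      using image[of 0] that zero by auto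
    then show "\<phi> 0 f = as_vector (\<epsilon> f)" "\<epsilon> f \<in> I"
      by (auto simp: \<epsilon>_def)
  qed
  have "minimal_graded_free_resolution I (\<lambda>i. B (Suc i)) (\<lambda>i. D (Suc i)) \<epsilon> (\<lambda>i. \<phi> (Suc i))"
  proof (rule minimal_graded_free_resolution.intro)
    interpret \<phi>: module_hom free_scale free_scale "\<phi> 0"
      by (rule hom)
    show "module_hom free_scale (*) \<epsilon>"
      by unfold_locales (simp_all add: \<epsilon>_def \<phi>.add \<phi>.scale lookup_add)
    show "homogeneous d (\<epsilon> f)"
      if "f \<in> free_submodule (B (Suc 0))" "free_homogeneous (D (Suc 0)) d f" for f d
      using graded[OF that] by (auto simp: zero \<epsilon>_def free_homogeneous_def)
    show "module_hom free_scale free_scale (\<phi> (Suc i))" for i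
      by (rule hom)
    show "free_homogeneous (D (Suc i)) d (\<phi> (Suc i) f)"
      if "f \<in> free_submodule (B (Suc (Suc i)))" "free_homogeneous (D (Suc (Suc i))) d f" for i f d
      using that by (rule graded)
    show "\<epsilon> ` free_submodule (B (Suc 0)) = I"
    proof
      show "\<epsilon> ` free_submodule (B (Suc 0)) \<subseteq> I"
        using \<epsilon>(2) by auto
      show "I \<subseteq> \<epsilon> ` free_submodule (B (Suc 0))"
      proof
        fix p assume "p \<in> I"
        then have "as_vector p \<in> \<phi> 0 ` free_submodule (B (Suc 0))"
          using image[of 0] zero by simp
        then obtain f where "f \<in> free_submodule (B (Suc 0))" "\<phi> 0 f = as_vector p"
          by auto
        then show "p \<in> \<epsilon> ` free_submodule (B (Suc 0))"
          by (intro image_eqI[of _ _ f]) (simp_all add: \<epsilon>_def)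
      qed
    qed
    show "{f \<in> free_submodule (B (Suc 0)). \<epsilon> f = 0} = \<phi> (Suc 0) ` free_submodule (B (Suc 1))"
      using image[of 1] M_Suc[of 0] \<epsilon>(1) by auto
    show "{f \<in> free_submodule (B (Suc (Suc i))). \<phi> (Suc i) f = 0} =
        \<phi> (Suc (Suc i)) ` free_submodule (B (Suc (Suc (Suc i))))" for i
      using image[of "Suc (Suc i)"] M_Suc[of "Suc i"] by simp
    show "coeff (\<phi> (Suc i) f) b \<in> irrelevant_ideal" if "f \<in> free_submodule (B (Suc (Suc i)))" for f i b
    proof -
      have "\<phi> (Suc i) f \<in> M (Suc i)"
        using image[of "Suc i"] that by blast
      then show ?thesis
        using minimal_cover.minimal[OF cov[of i]] by (simp add: M_Suc irrelevant_ideal_iff)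
    qed
  qed
  then show ?thesis
    by blast
qed

text \<open>The vanishing bounds the shifted degrees in every resolution. The last assumption keeps
  \<open>p\<close> out of the irrelevant ideal times \<open>I\<close>, which forces a basis vector
  of degree \<open>r\<close> in position 0, where the bound is attained.\<close>

lemma regularity_eqI:
  fixes I :: "('v::finite, 'k::field) mpoly set"
  assumes "is_ideal I" "\<And>f d. f \<in> I \<Longrightarrow> hom_comp d f \<in> I"
    and vanishing: "\<And>i j. j > int i + r \<Longrightarrow> koszul_vanishing (\<lambda>_. 0) (as_vector ` I) i j"
    and generator: "p \<in> I" "homogeneous r p" "\<And>h. (\<And>v. h v \<in> I) \<Longrightarrow> p \<noteq> (\<Sum>v\<in>UNIV. Var v * h v)"
  shows "regularity I = ereal (of_int r)"
  unfolding regularity_def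
proof (rule antisym)
  show "Sup {ereal (of_int (j - int i)) | i j. has_syzygy_degree I i j} \<le> ereal (of_int r)"
  proof (rule Sup_least, clarify)
    fix i j assume "has_syzygy_degree I i j"
    then obtain B D \<epsilon> \<delta> b where "minimal_graded_free_resolution I B D \<epsilon> \<delta>" "b \<in> B i" "D i b = j"
      by (auto simp: has_syzygy_degree_def)
    then have "j \<le> int i + r"
      using minimal_graded_free_resolution.basis_degree_bound[OF _ vanishing] by metis
    then show "ereal (of_int (j - int i)) \<le> ereal (of_int r)"
      by simp
  qed
  obtain B D \<epsilon> \<delta> where res: "minimal_graded_free_resolution I B D \<epsilon> \<delta>"
    using exists_minimal_graded_free_resolution[OF assms(1,2)] by blast
  obtain b where "b \<in> B 0" "D 0 b = r"
    using minimal_graded_free_resolution.generator_degree[OF res generator] by blast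
  with res have "has_syzygy_degree I 0 r"
    unfolding has_syzygy_degree_def by blast
  then show "ereal (of_int r) \<le> Sup {ereal (of_int (j - int i)) | i j. has_syzygy_degree I i j}"
    by (intro Sup_upper) force
qed

section \<open>Powers of the edge ideal of a complete graph\<close>

text \<open>The order of a monomial along the prime generated by all variables other than that of
  \<open>v\<close>. For a complete graph the minimal vertex covers are the complements of single
  vertices, so these are the primes that cut out the symbolic powers.\<close>

definition degree_off :: "'v::finite \<Rightarrow> ('v \<Rightarrow>\<^sub>0 nat) \<Rightarrow> nat" where
  "degree_off v m = (\<Sum>u\<in>-{v}. coeff m u)"

lemma degree_off_add: "degree_off v (a + b) = degree_off v a + degree_off v b"
  by (simp add: degree_off_def lookup_add sum.distrib)

lemma degree_off_unit_exp [simp]: "degree_off v (unit_exp u) = of_bool (u \<noteq> v)"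
  by (auto simp: degree_off_def)

lemma monom_degree_conv_degree_off: "monom_degree m = coeff m v + degree_off v m"
proof -
  have "UNIV = insert v (- {v})"
    by auto
  then show ?thesis
    unfolding monom_degree_def degree_off_def by (metis ComplD finite insertI1 sum.insert)
qed

lemma coeff_le_degree_off: "u \<noteq> v \<Longrightarrow> coeff m u \<le> degree_off v m"
  unfolding degree_off_def by (rule member_le_sum) auto

section \<open>Monomial ideals given by sets of exponents\<close>

definition supported_in :: "('v::finite \<Rightarrow>\<^sub>0 nat) set \<Rightarrow> ('v, 'k::field) mpoly set" where
  "supported_in A = {f. supp f \<subseteq> A}"

lemma is_ideal_supported_in:
  assumes "\<And>a b. a \<in> A \<Longrightarrow> b + a \<in> A"
  shows "is_ideal (supported_in A)"
proof (rule self_module.subspaceI)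
  show "f + g \<in> supported_in A" if "f \<in> supported_in A" "g \<in> supported_in A" for f g
    using that keys_add[of f g] by (auto simp: supported_in_def)
  show "r * f \<in> supported_in A" if "f \<in> supported_in A" for r f
    using that keys_mult[of r f] assms by (fastforce simp: supported_in_def)
qed (simp add: supported_in_def)

lemma hom_comp_supported_in: "f \<in> supported_in A \<Longrightarrow> hom_comp d f \<in> supported_in A"
  by (auto simp: supported_in_def in_keys_iff split: if_splits)

lemma supported_in_subsetI:
  fixes J :: "('v::finite, 'k::field) mpoly set"
  assumes "is_ideal J" "\<And>m c. m \<in> A \<Longrightarrow> Poly_Mapping.single m c \<in> J"
  shows "supported_in A \<subseteq> J"
proof
  fix f :: "('v, 'k) mpoly" assume "f \<in> supported_in A"
  then have "(\<Sum>m\<in>supp f. Poly_Mapping.single m (coeff f m)) \<in> J"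
    by (intro self_module.subspace_sum[OF assms(1)] assms(2)) (auto simp: supported_in_def)
  then show "f \<in> J"
    by (simp add: sum_monomials)
qed

text \<open>The homotopy divides by the cone variable and must not leave the ideal. The condition
  concerns only faces missing the cone vertex, as no other coefficients are divided, and only
  degrees above \<open>r\<close>, since on faces of size \<open>i\<close> the coefficients have
  degree \<open>j - i\<close>.\<close>

lemma koszul_vanishing_supported_in:
  fixes A :: "('v::finite \<Rightarrow>\<^sub>0 nat) set" and c :: "('v \<Rightarrow>\<^sub>0 nat) \<Rightarrow> 'v"
  assumes cone: "\<And>m \<tau>. \<lbrakk>m \<in> A; r < int (monom_degree m); c (m + square_free_exp \<tau>) \<notin> \<tau>\<rbrakk> \<Longrightarrow>
      coeff m (c (m + square_free_exp \<tau>)) \<noteq> 0 \<and> m - unit_exp (c (m + square_free_exp \<tau>)) \<in> A"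
    and j: "int i + r < j"
  shows "koszul_vanishing (\<lambda>_. 0) (as_vector ` (supported_in A :: ('v, 'k::field) mpoly set)) i j"
  unfolding koszul_vanishing_def
proof (intro allI impI)
  let ?M = "as_vector ` (supported_in A :: ('v, 'k) mpoly set)"
  fix z :: "'v set \<Rightarrow> (nat \<Rightarrow>\<^sub>0 ('v, 'k) mpoly)"
  assume *: "\<forall>\<tau>. z \<tau> \<in> ?M \<and> free_homogeneous (\<lambda>_. 0) (j - int (card \<tau>)) (z \<tau>) \<and>
    (card \<tau> \<noteq> i \<longrightarrow> z \<tau> = 0) \<and> koszul_d z \<tau> = 0"
  then have z: "\<And>\<tau>. koszul_d z \<tau> = 0" "\<And>\<tau>. free_homogeneous (\<lambda>_. 0) (j - int (card \<tau>)) (z \<tau>)"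
      "\<And>\<tau>. card \<tau> \<noteq> i \<longrightarrow> z \<tau> = 0"
    by auto
  have supp_z: "b = 0 \<and> m \<in> A \<and> r < int (monom_degree m)" if m: "m \<in> supp (coeff (z \<tau>) b)" for \<tau> b m
  proof -
    obtain p where p: "z \<tau> = as_vector p" "supp p \<subseteq> A"
      using * by (force simp: supported_in_def)
    then have "b = 0" "m \<in> A"
      using m by (auto simp: lookup_single when_def split: if_splits)
    moreover have "card \<tau> = i"
      using z(3) m by force
    moreover have "int (monom_degree m) + 0 = j - int (card \<tau>)"
      using m by (intro free_homogeneousD[OF z(2)]) (simp add: in_keys_iff)
    ultimately show ?thesis
      using j by simp
  qed
  have c: "coeff (m + square_free_exp \<tau>) (c (m + square_free_exp \<tau>)) \<noteq> 0"
    if "m \<in> supp (coeff (z \<tau>) b)" for \<tau> b m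
    using supp_z[OF that] cone[of m \<tau>]
    by (cases "c (m + square_free_exp \<tau>) \<in> \<tau>") (auto simp: lookup_add)
  obtain w where w: "\<And>\<sigma>. free_homogeneous (\<lambda>_. 0) (j - int (card \<sigma>)) (w \<sigma>)"
      "\<And>\<sigma>. card \<sigma> \<noteq> Suc i \<longrightarrow> w \<sigma> = 0" "\<And>\<sigma>. koszul_d w \<sigma> = z \<sigma>"
    and supp_w: "\<And>\<sigma> b m. m \<in> supp (coeff (w \<sigma>) b) \<longrightarrow> c (m + square_free_exp \<sigma>) \<in> \<sigma> \<and>
      m + unit_exp (c (m + square_free_exp \<sigma>)) \<in> supp (coeff (z (\<sigma> - {c (m + square_free_exp \<sigma>)})) b)"
    using graded_koszul_cone[of z c "\<lambda>_. 0" j i, OF z(1) _ z(2)] c z(3) by blast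
  have "w \<sigma> \<in> ?M" for \<sigma>
  proof -
    have mem: "b = 0 \<and> m \<in> A" if m: "m \<in> supp (coeff (w \<sigma>) b)" for b m
    proof -
      define v where "v = c (m + square_free_exp \<sigma>)"
      have v: "v \<in> \<sigma>" "m + unit_exp v \<in> supp (coeff (z (\<sigma> - {v})) b)"
        using supp_w m by (auto simp: v_def)
      \<comment> \<open>Moving \<open>v\<close> from the face to the monomial preserves the
        multidegree, so the cone vertex chosen there is again \<open>v\<close>.\<close>
      have "m + unit_exp v + square_free_exp (\<sigma> - {v}) = m + square_free_exp \<sigma>"
        using v(1) by (intro poly_mapping_eqI) (auto simp: lookup_add)
      then have "c (m + unit_exp v + square_free_exp (\<sigma> - {v})) = v"
        by (simp add: v_def)
      then have "m + unit_exp v - unit_exp v \<in> A"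
        using cone[of "m + unit_exp v" "\<sigma> - {v}"] supp_z[OF v(2)] by auto
      then show ?thesis
        using supp_z[OF v(2)] by simp
    qed
    have "w \<sigma> = as_vector (coeff (w \<sigma>) 0)"
    proof (intro poly_mapping_eqI)
      show "coeff (coeff (w \<sigma>) b) m = coeff (coeff (as_vector (coeff (w \<sigma>) 0)) b) m" for b m
        using mem[of m b] by (auto simp: lookup_single when_def in_keys_iff)
    qed
    moreover have "coeff (w \<sigma>) 0 \<in> supported_in A"
      using mem by (auto simp: supported_in_def)
    ultimately show ?thesis
      by (rule image_eqI)
  qed
  with w show "\<exists>w. \<forall>\<sigma>. w \<sigma> \<in> ?M \<and> free_homogeneous (\<lambda>_. 0) (j - int (card \<sigma>)) (w \<sigma>) \<and>
    (card \<sigma> \<noteq> Suc i \<longrightarrow> w \<sigma> = 0) \<and> koszul_d w \<sigma> = z \<sigma>"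
    by blast
qed

section \<open>Combinatorics of the exponents of the two powers\<close>

definition symbolic_exps :: "nat \<Rightarrow> ('v::finite \<Rightarrow>\<^sub>0 nat) set" where
  "symbolic_exps s = {m. \<forall>v. s \<le> degree_off v m}"

definition ordinary_exps :: "nat \<Rightarrow> ('v::finite \<Rightarrow>\<^sub>0 nat) set" where
  "ordinary_exps s = {m \<in> symbolic_exps s. 2 * s \<le> monom_degree m}"

lemma symbolic_exps_add: "a \<in> symbolic_exps s \<Longrightarrow> b + a \<in> symbolic_exps s"
  by (auto simp: symbolic_exps_def degree_off_add intro: trans_le_add2)

lemma ordinary_exps_add: "a \<in> ordinary_exps s \<Longrightarrow> b + a \<in> ordinary_exps s"
  by (simp add: ordinary_exps_def symbolic_exps_add monom_degree_add)

text \<open>The constraint at \<open>v\<close> itself is unaffected. For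
  \<open>u \<noteq> v\<close>, maximality gives
  \<open>coeff m u \<le> coeff m v \<le> degree_off u m\<close>. The outer two terms add up to more
  than \<open>2 * s\<close>, so \<open>degree_off u m\<close> exceeds \<open>s\<close> and can
  afford to lose one.\<close>

lemma lower_max_exp:
  assumes m: "m \<in> symbolic_exps s" "2 * s < monom_degree m" and v: "\<And>u. coeff m u \<le> coeff m v"
  shows "coeff m v \<noteq> 0" "m - unit_exp v \<in> ordinary_exps s"
proof -
  show "coeff m v \<noteq> 0"
  proof
    assume "coeff m v = 0"
    then have "m = 0"
      using v by (intro poly_mapping_eqI) (simp add: le_zero_eq)
    with m(2) show False
      by simp
  qed
  then have "m - unit_exp v + unit_exp v = m"
    by (intro exp_minus_plus) auto
  then obtain m' where m': "m = m' + unit_exp v" "m' = m - unit_exp v"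
    by metis
  have "s \<le> degree_off u m'" for u
  proof (cases "u = v")
    case True
    have "s \<le> degree_off v m"
      using m(1) by (simp add: symbolic_exps_def)
    then show ?thesis
      using True by (simp add: m'(1) degree_off_add)
  next
    case False
    have "coeff m u + degree_off u m > 2 * s"
      using m(2) monom_degree_conv_degree_off[of m u] by simp
    moreover have "coeff m v \<le> degree_off u m"
      using False by (intro coeff_le_degree_off) simp
    moreover have "degree_off u m = degree_off u m' + 1"
      using False by (simp add: m'(1) degree_off_add)
    ultimately show ?thesis
      using v[of u] by linarith
  qed
  moreover have "2 * s \<le> monom_degree m'"
    using m(2) by (simp add: m'(1) monom_degree_add)
  ultimately show "m - unit_exp v \<in> ordinary_exps s"
    by (simp add: ordinary_exps_def symbolic_exps_def m'(2))
qed

lemma koszul_vanishing_exps: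
  assumes A: "ordinary_exps s \<subseteq> A" "A \<subseteq> symbolic_exps s" and j: "int i + int (2 * s) < j"
  shows "koszul_vanishing (\<lambda>_. 0) (as_vector ` (supported_in A :: ('v::finite, 'k::field) mpoly set)) i j"
proof -
  define c where "c a = arg_max (coeff a) (\<lambda>_. True)" for a :: "'v \<Rightarrow>\<^sub>0 nat"
  have c: "coeff a u \<le> coeff a (c a)" for a u
    unfolding c_def by (rule arg_max_nat_le[where b = "Suc (monom_degree a)"])
      (auto simp: monom_degree_def less_Suc_eq_le intro: member_le_sum)
  show ?thesis
  proof (rule koszul_vanishing_supported_in[OF _ j, of _ c])
    fix m :: "'v \<Rightarrow>\<^sub>0 nat" and \<tau>
    assume m: "m \<in> A" "int (2 * s) < int (monom_degree m)" and "c (m + square_free_exp \<tau>) \<notin> \<tau>"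
    \<comment> \<open>The vertex maximises the exponents of the multidegree. Since it avoids
      \<open>\<tau>\<close>, its exponent there is the one in \<open>m\<close>, and so it is maximal
      for \<open>m\<close> as well.\<close>
    then have "coeff m u \<le> coeff m (c (m + square_free_exp \<tau>))" for u
      using c[of "m + square_free_exp \<tau>" u] by (simp add: lookup_add)
    with m A show "coeff m (c (m + square_free_exp \<tau>)) \<noteq> 0 \<and> m - unit_exp (c (m + square_free_exp \<tau>)) \<in> A"
      using lower_max_exp[of m s "c (m + square_free_exp \<tau>)"] by auto
  qed
qed

text \<open>The edge joins vertices \<open>u\<close> and \<open>v\<close> with the two largest
  exponents. At these two vertices \<open>degree_off\<close> drops by one only. At another vertex
  \<open>w\<close> it drops by two, but \<open>2 * coeff m w \<le> degree_off w m\<close> and total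
  degree at least \<open>2 * s + 2\<close> force \<open>degree_off w m \<ge> s + 2\<close>.\<close>

lemma split_edge:
  assumes "m \<in> ordinary_exps (Suc s)"
  obtains u v m' where "u \<noteq> v" "m = unit_exp u + unit_exp v + m'" "m' \<in> ordinary_exps s"
proof -
  have m: "Suc s \<le> degree_off w m" "2 * s + 2 \<le> monom_degree m" for w
    using assms by (auto simp: ordinary_exps_def symbolic_exps_def)
  obtain u where u: "\<And>w. coeff m w \<le> coeff m u"
  proof -
    have "Max (range (coeff m)) \<in> range (coeff m)"
      by (intro Max_in) auto
    then obtain u where u: "Max (range (coeff m)) = coeff m u"
      by blast
    show thesis
      by (rule that[of u]) (simp add: u[symmetric])
  qed
  have "\<exists>w. w \<noteq> u \<and> coeff m w \<noteq> 0"
  proof (rule ccontr)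
    assume "\<nexists>w. w \<noteq> u \<and> coeff m w \<noteq> 0"
    then have "degree_off u m = 0"
      unfolding degree_off_def by (intro sum.neutral) blast
    with m(1)[of u] show False
      by simp
  qed
  then obtain w\<^sub>0 where w\<^sub>0: "w\<^sub>0 \<noteq> u" "coeff m w\<^sub>0 \<noteq> 0"
    by blast
  obtain v where v: "v \<noteq> u" "\<And>w. w \<noteq> u \<Longrightarrow> coeff m w \<le> coeff m v"
  proof -
    have "Max (coeff m ` (- {u})) \<in> coeff m ` (- {u})"
      using w\<^sub>0 by (intro Max_in) auto
    then obtain v where v: "v \<noteq> u" "Max (coeff m ` (- {u})) = coeff m v"
      by blast
    show thesis
      by (rule that[of v]) (simp_all add: v(1) v(2)[symmetric])
  qed
  have pos: "0 < coeff m v" "0 < coeff m u"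
    using w\<^sub>0 v(2)[of w\<^sub>0] u[of v] by auto
  define m' where "m' = m - (unit_exp u + unit_exp v)"
  have "m' + (unit_exp u + unit_exp v) = m"
    unfolding m'_def using pos v(1) by (intro exp_minus_plus) (auto simp: lookup_add)
  then have m': "m = unit_exp u + unit_exp v + m'"
    by (simp add: add.commute)
  have "s \<le> degree_off w m'" for w
  proof (cases "w = u \<or> w = v")
    case True
    then show ?thesis
      using m(1)[of w] v(1) by (auto simp: m' degree_off_add)
  next
    case False
    have "coeff m u + coeff m v = sum (coeff m) {u, v}"
      using v(1) by simp
    also have "\<dots> \<le> degree_off w m"
      unfolding degree_off_def using False by (intro sum_mono2) auto
    finally have "coeff m u + coeff m v \<le> degree_off w m" .
    moreover have "coeff m w \<le> coeff m v"
      using False by (intro v(2)) simp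
    moreover have "2 * s + 2 \<le> coeff m w + degree_off w m"
      using m(2) monom_degree_conv_degree_off[of m w] by simp
    moreover have "degree_off w m = degree_off w m' + 2"
      using False by (auto simp: m' degree_off_add)
    ultimately show ?thesis
      using u[of v] by linarith
  qed
  moreover have "2 * s \<le> monom_degree m'"
    using m(2) by (simp add: m' monom_degree_add)
  ultimately have "m' \<in> ordinary_exps s"
    by (simp add: ordinary_exps_def symbolic_exps_def)
  with m' v(1) show thesis
    using that by metis
qed

section \<open>Ordinary powers\<close>

lemma is_ideal_ideal_mult: "is_ideal (ideal_mult I J)"
  unfolding ideal_mult_def by (rule self_module.subspace_span)

lemma ideal_mult_memI: "\<lbrakk>a \<in> I; b \<in> J\<rbrakk> \<Longrightarrow> a * b \<in> ideal_mult I J"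
  unfolding ideal_mult_def by (rule self_module.span_base) blast

lemma is_ideal_symbolic_exps: "is_ideal (supported_in (symbolic_exps s))"
  by (intro is_ideal_supported_in symbolic_exps_add)

lemma is_ideal_ordinary_exps: "is_ideal (supported_in (ordinary_exps s))"
  by (intro is_ideal_supported_in ordinary_exps_add)

definition complete_edge_ideal :: "('v::finite, 'k::field) mpoly set" where
  "complete_edge_ideal = ideal_gen {Var u * Var v | u v. u \<noteq> v}"

lemma complete_edge_ideal_eq: "complete_edge_ideal = supported_in (ordinary_exps 1)"
proof
  show "complete_edge_ideal \<subseteq> (supported_in (ordinary_exps 1) :: ('a, 'b) mpoly set)"
    unfolding complete_edge_ideal_def
  proof (rule self_module.span_minimal[OF _ is_ideal_ordinary_exps])
    show "{Var u * Var v |u v. u \<noteq> v} \<subseteq> (supported_in (ordinary_exps 1) :: ('a, 'b) mpoly set)"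
      by (auto simp: Var_eq mult_single supported_in_def ordinary_exps_def symbolic_exps_def
          degree_off_add monom_degree_add)
  qed
  show "(supported_in (ordinary_exps 1) :: ('a, 'b) mpoly set) \<subseteq> complete_edge_ideal"
  proof (rule supported_in_subsetI)
    show "is_ideal (complete_edge_ideal :: ('a, 'b) mpoly set)"
      unfolding complete_edge_ideal_def by (rule self_module.subspace_span)
    fix m :: "'a \<Rightarrow>\<^sub>0 nat" and c :: 'b assume "m \<in> ordinary_exps 1"
    then have "m \<in> ordinary_exps (Suc 0)"
      by simp
    then obtain u v m' where m: "u \<noteq> v" "m = unit_exp u + unit_exp v + m'" "m' \<in> ordinary_exps 0"
      by (rule split_edge)
    have eq: "Poly_Mapping.single m c = Poly_Mapping.single m' c * (Var u * Var v)"
      by (simp add: Var_eq mult_single m(2) add.commute)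
    show "Poly_Mapping.single m c \<in> complete_edge_ideal"
      unfolding complete_edge_ideal_def eq using m(1)
      by (intro self_module.span_scale self_module.span_base) blast
  qed
qed

text \<open>The defining inequalities add up under multiplication of monomials; conversely,
  \<open>split_edge\<close> factors a generator of the edge ideal out of each monomial.\<close>

lemma ideal_power_complete: "ideal_power complete_edge_ideal s = supported_in (ordinary_exps s)"
proof (induction s)
  case 0
  show ?case
    by (simp add: supported_in_def ordinary_exps_def symbolic_exps_def)
next
  case (Suc s)
  let ?I = "complete_edge_ideal :: ('a, 'b) mpoly set"
  have "ideal_mult ?I (supported_in (ordinary_exps s)) = supported_in (ordinary_exps (Suc s))"
  proof
    show "ideal_mult ?I (supported_in (ordinary_exps s)) \<subseteq> supported_in (ordinary_exps (Suc s))"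
      unfolding ideal_mult_def
    proof (rule self_module.span_minimal[OF _ is_ideal_ordinary_exps], clarify)
      fix f g :: "('a, 'b) mpoly" assume fg: "f \<in> ?I" "g \<in> supported_in (ordinary_exps s)"
      have "a + b \<in> ordinary_exps (Suc s)" if "a \<in> ordinary_exps 1" "b \<in> ordinary_exps s" for a b :: "'a \<Rightarrow>\<^sub>0 nat"
        using that by (auto simp: ordinary_exps_def symbolic_exps_def degree_off_add monom_degree_add
            intro: add_mono[of 1 _ s, simplified])
      then show "f * g \<in> supported_in (ordinary_exps (Suc s))"
        using fg keys_mult[of f g] unfolding complete_edge_ideal_eq supported_in_def by fastforce
    qed
    show "supported_in (ordinary_exps (Suc s)) \<subseteq> ideal_mult ?I (supported_in (ordinary_exps s))"
    proof (rule supported_in_subsetI[OF is_ideal_ideal_mult])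
      fix m :: "'a \<Rightarrow>\<^sub>0 nat" and c :: 'b assume "m \<in> ordinary_exps (Suc s)"
      then obtain u v m' where m: "u \<noteq> v" "m = unit_exp u + unit_exp v + m'" "m' \<in> ordinary_exps s"
        by (rule split_edge)
      have "Poly_Mapping.single m c = (Var u * Var v) * Poly_Mapping.single m' c"
        by (simp add: Var_eq mult_single m(2))
      also have "\<dots> \<in> ideal_mult ?I (supported_in (ordinary_exps s))"
      proof (rule ideal_mult_memI)
        show "Var u * Var v \<in> ?I"
          unfolding complete_edge_ideal_def using m(1) by (intro self_module.span_base) blast
        show "Poly_Mapping.single m' c \<in> supported_in (ordinary_exps s)"
          using m(3) by (simp add: supported_in_def)
      qed
      finally show "Poly_Mapping.single m c \<in> ideal_mult ?I (supported_in (ordinary_exps s))" .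
    qed
  qed
  then show ?case
    by (simp add: Suc)
qed

section \<open>Associated primes and symbolic powers\<close>

text \<open>Leading terms for a monomial order (with respect to minima) that refines the weight.\<close>

lemma mult_min_weight:
  fixes f g :: "('v::finite, 'k::field) mpoly" and weight :: "('v \<Rightarrow>\<^sub>0 nat) \<Rightarrow> nat"
  assumes weight: "\<And>a b. weight (a + b) = weight a + weight b" and "f \<noteq> 0" "g \<noteq> 0"
  obtains a b where "a \<in> supp f" "b \<in> supp g" "a + b \<in> supp (f * g)"
    and "\<And>a'. a' \<in> supp f \<Longrightarrow> weight a \<le> weight a'" "\<And>b'. b' \<in> supp g \<Longrightarrow> weight b \<le> weight b'"
proof -
  \<comment> \<open>Polynomial mappings from naturals are linearly ordered lexicographically,
    compatibly with addition. Placing the weight at index 0 makes it decide first, and the exponents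
    break ties, so that \<open>\<Phi>\<close> is injective.\<close>
  define \<Phi> where "\<Phi> m = Poly_Mapping.single 0 (weight m) +
      (\<Sum>v\<in>UNIV. Poly_Mapping.single (Suc (to_nat v)) (coeff m v))" for m :: "'v \<Rightarrow>\<^sub>0 nat"
  have \<Phi>_0: "coeff (\<Phi> m) 0 = weight m" for m
    by (simp add: \<Phi>_def lookup_add lookup_sum lookup_single)
  have \<Phi>_Suc: "coeff (\<Phi> m) (Suc (to_nat v)) = coeff m v" for m v
    by (simp add: \<Phi>_def lookup_add lookup_sum lookup_single when_def)
  have \<Phi>_inj: "m = n" if "\<Phi> m = \<Phi> n" for m n
    by (rule poly_mapping_eqI) (metis that \<Phi>_Suc)
  have \<Phi>_add: "\<Phi> (m + n) = \<Phi> m + \<Phi> n" for m n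
    by (simp add: \<Phi>_def weight single_add lookup_add sum.distrib ac_simps)
  have \<Phi>_weight: "weight m \<le> weight n" if "\<Phi> m \<le> \<Phi> n" for m n
  proof (rule ccontr)
    assume "\<not> weight m \<le> weight n"
    then have "\<Phi> n < \<Phi> m"
      unfolding less_poly_mapping.rep_eq less_fun_def by (intro exI[of _ 0]) (simp add: \<Phi>_0)
    with that show False
      by simp
  qed
  have minimum: "\<exists>a\<in>supp p. \<forall>a'\<in>supp p. \<Phi> a \<le> \<Phi> a'" if "p \<noteq> 0" for p :: "('v, 'k) mpoly"
  proof -
    have "\<Phi> ` supp p \<noteq> {}" "finite (\<Phi> ` supp p)"
      using that by (auto simp: poly_mapping_eq_iff fun_eq_iff in_keys_iff)
    then have "Min (\<Phi> ` supp p) \<in> \<Phi> ` supp p"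
      by (intro Min_in)
    then obtain a where "a \<in> supp p" "\<Phi> a = Min (\<Phi> ` supp p)"
      by auto
    then show ?thesis
      by (intro bexI[of _ a]) auto
  qed
  obtain a where a: "a \<in> supp f" "\<And>a'. a' \<in> supp f \<Longrightarrow> \<Phi> a \<le> \<Phi> a'"
    using minimum[OF \<open>f \<noteq> 0\<close>] by blast
  obtain b where b: "b \<in> supp g" "\<And>b'. b' \<in> supp g \<Longrightarrow> \<Phi> b \<le> \<Phi> b'"
    using minimum[OF \<open>g \<noteq> 0\<close>] by blast
  \<comment> \<open>Minimality of \<open>a\<close> and \<open>b\<close> leaves only one way to write
    \<open>a + b\<close> as a sum of exponents from the two supports, so nothing can cancel in that
    coefficient.\<close>
  have unique: "l = a \<and> q = b" if "l \<in> supp f" "q \<in> supp g" "l + q = a + b" for l q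
  proof -
    have "\<Phi> l + \<Phi> q = \<Phi> a + \<Phi> b"
      using that(3) by (metis \<Phi>_add)
    moreover have "\<Phi> a \<le> \<Phi> l" "\<Phi> b \<le> \<Phi> q"
      using that a b by auto
    ultimately have "\<Phi> l = \<Phi> a" "\<Phi> q = \<Phi> b"
      by (metis add_le_cancel_left add_le_cancel_right add_mono antisym order_refl)+
    then show ?thesis
      using \<Phi>_inj by blast
  qed
  have "f * g = (\<Sum>l\<in>supp f. Poly_Mapping.single l (coeff f l)) * (\<Sum>q\<in>supp g. Poly_Mapping.single q (coeff g q))"
    by (simp add: sum_monomials)
  also have "\<dots> = (\<Sum>l\<in>supp f. \<Sum>q\<in>supp g. Poly_Mapping.single (l + q) (coeff f l * coeff g q))"
    by (simp add: sum_product mult_single)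
  finally have "coeff (f * g) (a + b) = (\<Sum>l\<in>supp f. \<Sum>q\<in>supp g. (coeff f l * coeff g q when l + q = a + b))"
    by (simp add: lookup_sum lookup_single)
  also have "\<dots> = (\<Sum>l\<in>supp f. \<Sum>q\<in>supp g. if l = a \<and> q = b then coeff f a * coeff g b else 0)"
    by (intro sum.cong refl) (use unique in \<open>auto simp: when_def\<close>)
  also have "\<dots> = (\<Sum>l\<in>supp f. if l = a then coeff f a * coeff g b else 0)"
    by (intro sum.cong refl) (use b(1) in auto)
  also have "\<dots> = coeff f a * coeff g b"
    using a(1) by simp
  finally have "a + b \<in> supp (f * g)"
    using a(1) b(1) by (simp add: in_keys_iff)
  with a b \<Phi>_weight show thesis
    using that by metis
qed

text \<open>A monomial that is not a power of one variable involves two of them, so the degree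
  condition is automatic for the first power.\<close>

lemma ordinary_exps_1: "m \<in> ordinary_exps 1 \<longleftrightarrow> (\<forall>v. 0 < degree_off v m)"
proof
  assume *: "\<forall>v. 0 < degree_off v m"
  then have "m \<noteq> 0"
    by (auto simp: degree_off_def)
  then obtain v m' where "m = unit_exp v + m'"
    using exp_eq_0_or_unit_exp_add by blast
  then have "0 < coeff m v"
    by (simp add: lookup_add)
  moreover have "0 < degree_off v m"
    using * by blast
  ultimately have "2 \<le> monom_degree m"
    by (simp add: monom_degree_conv_degree_off[of m v])
  with * show "m \<in> ordinary_exps 1"
    by (simp add: ordinary_exps_def symbolic_exps_def Suc_le_eq)
qed (auto simp: ordinary_exps_def symbolic_exps_def Suc_le_eq)

lemma mult_Var_in_complete_edge_ideal_iff:
  "g * Var v \<in> complete_edge_ideal \<longleftrightarrow> (\<forall>m\<in>supp g. m + unit_exp v \<in> ordinary_exps 1)"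
proof -
  have coeff: "coeff (g * Var v) m = (if coeff m v = 0 then 0 else coeff g (m - unit_exp v))" for m
    using coeff_unit_exp_mult[of v 1 g m] by (simp add: Var_eq mult.commute)
  have "supp (g * Var v) = (\<lambda>m. m + unit_exp v) ` supp g"
  proof (intro set_eqI iffI)
    fix m assume "m \<in> supp (g * Var v)"
    then have m: "coeff m v \<noteq> 0" "m - unit_exp v \<in> supp g"
      by (auto simp: in_keys_iff coeff split: if_splits)
    then have "m = m - unit_exp v + unit_exp v"
      by (subst exp_minus_plus) auto
    with m show "m \<in> (\<lambda>m. m + unit_exp v) ` supp g"
      by blast
  next
    fix m assume "m \<in> (\<lambda>m. m + unit_exp v) ` supp g"
    then show "m \<in> supp (g * Var v)"
      by (auto simp: in_keys_iff coeff lookup_add)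
  qed
  then show ?thesis
    by (auto simp: complete_edge_ideal_eq supported_in_def)
qed

text \<open>This ideal is generated by all variables except that of \<open>v\<close> and is the
  annihilator of \<open>Var v\<close> modulo the edge ideal. It is prime because the smallest value
  of \<open>degree_off v\<close> on a support is additive under products.\<close>

lemma vertex_prime:
  fixes v :: "'v::finite"
  defines "P \<equiv> supported_in {m. 0 < degree_off v m} :: ('v, 'k::field) mpoly set"
  shows "P \<in> associated_primes complete_edge_ideal"
proof -
  have "prime_ideal P"
    unfolding prime_ideal_def
  proof (intro conjI allI impI)
    show "is_ideal P"
      unfolding P_def by (rule is_ideal_supported_in) (auto simp: degree_off_add)
    have "1 \<notin> P"
      by (simp add: P_def supported_in_def degree_off_def)
    then show "P \<noteq> UNIV"
      by blast
    fix f g assume fg: "f * g \<in> P"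
    show "f \<in> P \<or> g \<in> P"
    proof (rule ccontr)
      assume "\<not> (f \<in> P \<or> g \<in> P)"
      then obtain a' b' where *: "a' \<in> supp f" "degree_off v a' = 0" "b' \<in> supp g" "degree_off v b' = 0"
        by (auto simp: P_def supported_in_def)
      then have "f \<noteq> 0" "g \<noteq> 0"
        by auto
      then obtain a b where "a + b \<in> supp (f * g)" "degree_off v a \<le> degree_off v a'" "degree_off v b \<le> degree_off v b'"
        using mult_min_weight[where f = f and g = g and weight = "degree_off v", OF degree_off_add] * by metis
      with * fg show False
        by (auto simp: P_def supported_in_def degree_off_add)
    qed
  qed
  moreover have "P = {g. g * Var v \<in> complete_edge_ideal}"
    by (auto simp: P_def supported_in_def mult_Var_in_complete_edge_ideal_iff ordinary_exps_1
        degree_off_add simp del: One_nat_def)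
  ultimately show ?thesis
    unfolding associated_primes_def by blast
qed

text \<open>Let \<open>P\<close> be the annihilator of \<open>h\<close>. As \<open>h\<close> lies
  outside the edge ideal, one of its monomials is a power of a single variable; multiplying by that
  variable preserves this, so the variable does not annihilate \<open>h\<close>.\<close>

lemma associated_prime_misses_Var:
  assumes "P \<in> associated_primes complete_edge_ideal"
  obtains v where "Var v \<notin> P"
proof -
  obtain h where P: "prime_ideal P" "P = {g. g * h \<in> complete_edge_ideal}"
    using assms by (auto simp: associated_primes_def)
  have "h \<notin> complete_edge_ideal"
  proof
    assume h: "h \<in> complete_edge_ideal"
    have "g * h \<in> complete_edge_ideal" for g
      using h unfolding complete_edge_ideal_def by (rule self_module.span_scale)
    with P show False
      by (auto simp: prime_ideal_def)
  qed
  then have "\<exists>m\<in>supp h. \<exists>v. \<not> 0 < degree_off v m"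
    unfolding complete_edge_ideal_eq supported_in_def using ordinary_exps_1 by blast
  then obtain m v where m: "m \<in> supp h" "degree_off v m = 0"
    by auto
  then have "m + unit_exp v \<notin> ordinary_exps 1"
    by (auto simp: ordinary_exps_1 degree_off_add simp del: One_nat_def)
  then have "h * Var v \<notin> complete_edge_ideal"
    using m(1) by (auto simp: mult_Var_in_complete_edge_ideal_iff)
  then show thesis
    using that[of v] by (simp add: P(2) mult.commute)
qed

lemma prime_ideal_power_notin:
  assumes "prime_ideal P" "x \<notin> P"
  shows "x ^ n \<notin> P"
proof (induction n)
  case 0
  show ?case
  proof
    assume "x ^ 0 \<in> P"
    then have "r * 1 \<in> P" for r
      using assms(1) self_module.subspace_scale[of P 1 r] by (simp add: prime_ideal_def)
    with assms(1) show False
      by (auto simp: prime_ideal_def)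
  qed
next
  case (Suc n)
  then show ?case
    using assms by (auto simp: prime_ideal_def)
qed

lemma Var_power: "Var v ^ n = Poly_Mapping.single (Poly_Mapping.single v n) 1"
  by (induction n) (simp_all add: Var_def mult_single single_add[symmetric])

text \<open>Localizing at a vertex prime bounds \<open>degree_off v\<close> from below: a multiplier
  outside that prime has a monomial of weight zero, and minimal weights add. Conversely, every
  associated prime misses a variable, and a power of it is a suitable multiplier.\<close>

lemma symbolic_power_complete:
  "symbolic_power complete_edge_ideal s = (supported_in (symbolic_exps s) :: ('v::finite, 'k::field) mpoly set)"
proof (intro set_eqI iffI)
  fix f :: "('v, 'k) mpoly"
  assume f: "f \<in> symbolic_power complete_edge_ideal s"
  have "s \<le> degree_off v m" if m: "m \<in> supp f" for v m
  proof -
    obtain g where g: "g \<notin> supported_in {m. 0 < degree_off v m}" "g * f \<in> supported_in (ordinary_exps s)"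
      using f vertex_prime[of v]
      by (auto simp: symbolic_power_def localization_contraction_def ideal_power_complete)
    then obtain a' where a': "a' \<in> supp g" "degree_off v a' = 0"
      by (auto simp: supported_in_def)
    then have "g \<noteq> 0" "f \<noteq> 0"
      using m by auto
    then obtain a b where ab: "a + b \<in> supp (g * f)" "degree_off v a \<le> degree_off v a'" "degree_off v b \<le> degree_off v m"
      using mult_min_weight[where f = g and g = f and weight = "degree_off v", OF degree_off_add] a'(1) m by metis
    then have "s \<le> degree_off v (a + b)"
      using g(2) by (auto simp: supported_in_def ordinary_exps_def symbolic_exps_def)
    with ab a' show ?thesis
      by (simp add: degree_off_add)
  qed
  then show "f \<in> supported_in (symbolic_exps s)"
    by (auto simp: supported_in_def symbolic_exps_def)
next
  fix f :: "('v, 'k) mpoly"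
  assume f: "f \<in> supported_in (symbolic_exps s)"
  show "f \<in> symbolic_power complete_edge_ideal s"
    unfolding symbolic_power_def localization_contraction_def ideal_power_complete
  proof (intro INT_I CollectI)
    fix P :: "('v, 'k) mpoly set" assume P: "P \<in> associated_primes complete_edge_ideal"
    then obtain v where v: "Var v \<notin> P"
      by (rule associated_prime_misses_Var)
    \<comment> \<open>The exponent \<open>2 * s\<close> lifts every monomial of \<open>f\<close> to
      the degree from which the symbolic and ordinary conditions agree.\<close>
    have "Var v ^ (2 * s) \<notin> P"
      using P v by (intro prime_ideal_power_notin) (auto simp: associated_primes_def)
    moreover have "Var v ^ (2 * s) * f \<in> supported_in (ordinary_exps s)"
    proof -
      have "Poly_Mapping.single v (2 * s) + m \<in> ordinary_exps s" if "m \<in> symbolic_exps s" for m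
      proof -
        have "Poly_Mapping.single v (2 * s) + m \<in> symbolic_exps s"
          by (rule symbolic_exps_add[OF that])
        moreover have "2 * s \<le> monom_degree (Poly_Mapping.single v (2 * s) + m)"
          using monom_degree_conv_degree_off[of "Poly_Mapping.single v (2 * s) + m" v]
          by (simp add: lookup_add)
        ultimately show ?thesis
          by (simp add: ordinary_exps_def)
      qed
      then show ?thesis
        using f keys_mult[of "Var v ^ (2 * s)" f] by (fastforce simp: supported_in_def Var_power)
    qed
    ultimately show "\<exists>g. g \<notin> P \<and> g * f \<in> supported_in (ordinary_exps s)"
      by blast
  qed
qed

section \<open>Regularity of both powers\<close>

lemma regularity_supported_in:
  fixes A :: "('v::finite \<Rightarrow>\<^sub>0 nat) set"
  assumes A: "ordinary_exps s \<subseteq> A" "A \<subseteq> symbolic_exps s"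
    and ideal: "is_ideal (supported_in A :: ('v, 'k::field) mpoly set)"
    and xy: "x \<noteq> (y :: 'v)" and s: "1 \<le> s"
  shows "regularity (supported_in A :: ('v, 'k) mpoly set) = ereal (of_int (int (2 * s)))"
proof (rule regularity_eqI[OF ideal hom_comp_supported_in])
  show "koszul_vanishing (\<lambda>_. 0) (as_vector ` (supported_in A :: ('v, 'k) mpoly set)) i j"
    if "int i + int (2 * s) < j" for i j
    using A that by (rule koszul_vanishing_exps)
  define m where "m = Poly_Mapping.single x s + Poly_Mapping.single y s"
  define p :: "('v, 'k) mpoly" where "p = Poly_Mapping.single m 1"
  have m_coeff: "coeff m u = (if u = x \<or> u = y then s else 0)" for u
    using xy by (auto simp: m_def lookup_add lookup_single when_def)
  have degree: "monom_degree m = 2 * s"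
  proof -
    have "monom_degree m = (\<Sum>u\<in>{x, y}. s)"
      unfolding monom_degree_def by (rule sum.mono_neutral_cong_right) (auto simp: m_coeff)
    then show ?thesis
      using xy by simp
  qed
  have "s \<le> degree_off v m" for v
    using monom_degree_conv_degree_off[of m v] degree by (auto simp: m_coeff split: if_splits)
  then have "m \<in> ordinary_exps s"
    by (simp add: ordinary_exps_def symbolic_exps_def degree)
  then show "p \<in> supported_in A"
    using A(1) by (auto simp: p_def supported_in_def)
  show "homogeneous (int (2 * s)) p"
    using homogeneous_single[of m 1] by (simp add: p_def degree)
  show "p \<noteq> (\<Sum>v\<in>UNIV. Var v * h v)" if h: "\<And>v. h v \<in> supported_in A" for h
  proof
    assume p: "p = (\<Sum>v\<in>UNIV. Var v * h v)"
    have "coeff (Var v * h v) m = 0" for v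
    proof (cases "v = x \<or> v = y")
      case True
      then have "m - unit_exp v + unit_exp v = m"
        using s by (intro exp_minus_plus) (auto simp: m_coeff)
      then obtain m' where m': "m = m' + unit_exp v" "m' = m - unit_exp v"
        by metis
      \<comment> \<open>The other one of the two vertices. Off \<open>u\<close> the monomial
        \<open>m\<close> has degree exactly \<open>s\<close>, all of it at \<open>v\<close>, so
        division by \<open>Var v\<close> violates even the symbolic condition. Hence
        \<open>p\<close> is indecomposable for every admissible \<open>A\<close>.\<close>
      define u where "u = (if v = x then y else x)"
      have "u \<noteq> v" "coeff m u = s"
        using True xy by (auto simp: u_def m_coeff)
      then have "degree_off u m' < s"
        using monom_degree_conv_degree_off[of m u] degree s by (simp add: m'(1) degree_off_add lookup_add)
      then have "m' \<notin> symbolic_exps s"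
        unfolding symbolic_exps_def using not_le by blast
      then have "m' \<notin> supp (h v)"
        using h[of v] A(2) by (auto simp: supported_in_def)
      then show ?thesis
        by (simp add: Var_eq coeff_unit_exp_mult m'(2) in_keys_iff)
    next
      case False
      then show ?thesis
        by (simp add: Var_eq coeff_unit_exp_mult m_coeff)
    qed
    then have "coeff p m = 0"
      by (simp add: p lookup_sum)
    then show False
      by (simp add: p_def)
  qed
qed

theorem theorem4p6:
  fixes G :: "('v::finite, 'e) pre_digraph"
    and I :: "('v, 'k::field) mpoly set"
    and n s :: nat
  assumes "complete_digraph n G"
    and "verts G = UNIV"
    and "I = edge_ideal G"
    and "s \<ge> 1"
  shows "regularity (symbolic_power I s) = regularity (ideal_power I s)"
proof -
  have I: "I = complete_edge_ideal"
    using assms(1,2) by (simp add: assms(3) edge_ideal_def complete_edge_ideal_def complete_digraph_def)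
  show ?thesis
  proof (cases "\<exists>x y :: 'v. x \<noteq> y")
    case True
    then obtain x y :: 'v where xy: "x \<noteq> y"
      by blast
    have "regularity (supported_in (symbolic_exps s) :: ('v, 'k) mpoly set) = ereal (of_int (int (2 * s)))"
      by (rule regularity_supported_in[OF _ _ is_ideal_symbolic_exps xy assms(4)])
        (auto simp: ordinary_exps_def)
    moreover have "regularity (supported_in (ordinary_exps s) :: ('v, 'k) mpoly set) = ereal (of_int (int (2 * s)))"
      by (rule regularity_supported_in[OF _ _ is_ideal_ordinary_exps xy assms(4)])
        (auto simp: ordinary_exps_def)
    ultimately show ?thesis
      by (simp add: I symbolic_power_complete ideal_power_complete)
  next
    case False
    then have "degree_off v m = 0" for v :: 'v and m
      unfolding degree_off_def by (intro sum.neutral) blast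
    then have "symbolic_exps s = ({} :: ('v \<Rightarrow>\<^sub>0 nat) set)"
      using assms(4) by (auto simp: symbolic_exps_def)
    then show ?thesis
      by (simp add: I symbolic_power_complete ideal_power_complete ordinary_exps_def)
  qed
qed

end
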